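(* Let $n \geq 2$, let $X$ be an $n$-dimensional normed space (that is, $\mathbb{R}^n$ with a norm) with unit ball $B_X \subset \mathbb{R}^n$, and let $K \subset \mathbb{R}^n$ be a convex body. Assume that $X$ is $p$-uniformly smooth with a constant $C>0$, for some $1 < p \leq 2$. If $d(K, B_X) \geq (1-\varepsilon)n$ for some $0 \leq \varepsilon \leq \varepsilon_0$, then $$d(K, S_n) \leq 1 + C_0 \varepsilon^{\frac{1}{q+1}},$$ where $q = p^* = \frac{p}{p-1}$, $$\varepsilon_0 = \frac{(q-1)^{q-1}}{q^q}\left(2^{q+1} \cdot 40^{q+1} \cdot C^{q-1} \cdot n^{5q+4}\right)^{-1} \quad\text{and}\quad C_0 = 40n^3\left(\frac{C^{q-1} 2^{2q+2} q^q n^{2q+1}}{(q-1)^{q-1}}\right)^{\frac{1}{q+1}}.$$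
   Context: A convex body in $\mathbb{R}^n$ is a compact convex set with non-empty interior. $S_n$ denotes the regular simplex in $\mathbb{R}^n$. The Banach-Mazur distance of convex bodies $K, L \subset \mathbb{R}^n$ is $d(K,L) = \inf\{ r > 0 : K+u \subset T(L+v) \subset r(K+u)\}$, the infimum being over all invertible linear operators $T:\mathbb{R}^n\to\mathbb{R}^n$ and all $u,v\in\mathbb{R}^n$. For a normed space $X$, the modulus of smoothness is $\rho_X(t) = \sup\left\{\frac{\|x+ty\| + \|x-ty\| - 2}{2} : \|x\| = \|y\| = 1\right\}$ for $t \geq 0$. For $1 < p \leq 2$ and $C > 0$, $X$ is called $p$-uniformly smooth with a constant $C$ if $\rho_X(t) \leq C t^p$ for every $t \geq 0$. *)

theory Defs
  imports "HOL-Analysis.Analysis"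
begin

text \<open>
  Norms on \<open>\<real>\<^sup>n\<close> are explicit functions, since the type class norm of \<^typ>\<open>real^'n\<close> is the
  Euclidean one.
\<close>

definition is_norm :: "(real^'n \<Rightarrow> real) \<Rightarrow> bool" where
  "is_norm N \<longleftrightarrow>
     (\<forall>x. 0 \<le> N x) \<and> (\<forall>x. N x = 0 \<longleftrightarrow> x = 0) \<and>
     (\<forall>c x. N (c *\<^sub>R x) = \<bar>c\<bar> * N x) \<and>
     (\<forall>x y. N (x + y) \<le> N x + N y)"

definition unit_ball :: "(real^'n \<Rightarrow> real) \<Rightarrow> (real^'n) set" where
  "unit_ball N = {x. N x \<le> 1}"

definition convex_body :: "(real^'n) set \<Rightarrow> bool" where
  "convex_body K \<longleftrightarrow> compact K \<and> convex K \<and> interior K \<noteq> {}"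

text \<open>
  Regularity is with respect to the Euclidean distance. Any two such simplices differ by a
  similarity.
\<close>

definition regular_simplex :: "(real^'n) set \<Rightarrow> bool" where
  "regular_simplex S \<longleftrightarrow>
     (\<exists>V s. \<not> affine_dependent V \<and> card V = CARD('n) + 1 \<and> S = convex hull V \<and>
            (\<forall>x\<in>V. \<forall>y\<in>V. x \<noteq> y \<longrightarrow> dist x y = s))"

text \<open>
  For convex bodies the set below is nonempty and bounded below by \<open>0\<close>, so the real \<open>Inf\<close> is
  the genuine infimum.
\<close>

definition banach_mazur_dist :: "(real^'n) set \<Rightarrow> (real^'n) set \<Rightarrow> real" where
  "banach_mazur_dist K L =
     Inf {r. 0 < r \<and>
       (\<exists>T u v. linear T \<and> bij T \<and>
          (+) u ` K \<subseteq> T ` ((+) v ` L) \<and>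
          T ` ((+) v ` L) \<subseteq> (*\<^sub>R) r ` ((+) u ` K))}"

text \<open>
  For a norm and \<open>t \<ge> 0\<close> the set below is nonempty and, by the triangle inequality, bounded
  above by \<open>t\<close>, so the real \<open>Sup\<close> is the genuine supremum.
\<close>

definition modulus_of_smoothness :: "(real^'n \<Rightarrow> real) \<Rightarrow> real \<Rightarrow> real" where
  "modulus_of_smoothness N t =
     Sup {(N (x + t *\<^sub>R y) + N (x - t *\<^sub>R y) - 2) / 2 | x y. N x = 1 \<and> N y = 1}"

definition uniformly_smooth :: "(real^'n \<Rightarrow> real) \<Rightarrow> real \<Rightarrow> real \<Rightarrow> bool" where
  "uniformly_smooth N p C \<longleftrightarrow> (\<forall>t\<ge>0. modulus_of_smoothness N t \<le> C * t powr p)"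

end

theory Submission
  imports Defs
begin

text \<open>
  Place the unit ball \<open>B\<close> in \<open>K\<close> as an affine image of maximal volume; after an affine change of
  coordinates it is \<open>B\<close> itself. A version of John's theorem (\<open>john_decomposition\<close>) provides contact pairs
  \<open>(x\<^sub>i, y\<^sub>i)\<close> of \<open>B\<close> and \<open>K\<close>, with weights \<open>a\<^sub>i\<close> of sum 1, such that \<open>\<Sum> a\<^sub>i y\<^sub>i = 0\<close> and \<open>n \<Sum> a\<^sub>i (y\<^sub>i \<bullet> v) x\<^sub>i = v\<close>
  for all \<open>v\<close>. A translate of \<open>\<alpha> B\<close> with \<open>\<alpha> > 1\<close> containing \<open>K\<close> would show that the distance of \<open>K\<close> and \<open>B\<close>
  is at most \<open>\<alpha>\<close>, so no translate with \<open>\<alpha> < R = (1 - \<epsilon>) n\<close> contains \<open>K\<close>. By duality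
  (\<open>circumscribed_ball_duality\<close>) there are points \<open>X\<^sub>k\<close> of \<open>K\<close> and functionals \<open>u\<^sub>k\<close> of dual norm at most 1,
  with weights \<open>b\<^sub>k\<close> of sum 1, such that \<open>\<Sum> b\<^sub>k u\<^sub>k = 0\<close> and \<open>\<Sum> b\<^sub>k (u\<^sub>k \<bullet> X\<^sub>k) = R\<close>. Together these identities give

  \<open>\<Sum> a\<^sub>i b\<^sub>k (1 - y\<^sub>i \<bullet> X\<^sub>k) (1 + u\<^sub>k \<bullet> x\<^sub>i) = 1 - R / n = \<epsilon>\<close>,

  where all terms are nonnegative. This is where smoothness enters: if \<open>1 + u\<^sub>k \<bullet> x\<^sub>i\<close> is small, then both
  \<open>y\<^sub>i\<close> and \<open>-u\<^sub>k\<close> nearly norm \<open>x\<^sub>i\<close>, hence \<open>y\<^sub>i\<close> is close to \<open>-u\<^sub>k\<close>, with a power \<open>q\<close> coming from the uniform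
  convexity of the dual (\<open>dual_functionals_close_of_uniformly_smooth\<close>). So, up to small errors, for each \<open>k\<close>
  the functionals \<open>y\<^sub>i\<close> either equal \<open>-u\<^sub>k\<close> or take the value 1 at \<open>X\<^sub>k\<close>.

  Suppose for a moment that \<open>\<epsilon> = 0\<close>. Then \<open>R = n\<close> and the alternative is exact; also each \<open>-u\<^sub>k\<close> is one of the
  \<open>y\<^sub>i\<close>. Merge indices with equal \<open>u\<^sub>k\<close>, averaging their points. For \<open>k \<noteq> l\<close> one gets
  \<open>u\<^sub>k \<bullet> X\<^sub>l = -1\<close>, and evaluating \<open>\<Sum> b\<^sub>k u\<^sub>k = 0\<close> at \<open>X\<^sub>l\<close> yields \<open>b\<^sub>l (1 + u\<^sub>l \<bullet> X\<^sub>l) = 1\<close>. Summing over \<open>l\<close> shows that the number of distinct indices is \<open>1 + R\<close>, that is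
  \<open>n + 1\<close>. Thus \<open>K\<close> contains the \<open>n + 1\<close> points \<open>X\<^sub>k\<close> and is bounded by the \<open>n + 1\<close> hyperplanes
  \<open>u\<^sub>k = -1\<close>, each of which passes through all the points but one: \<open>K\<close> is a simplex. The quantitative form of
  this count is \<open>near_diagonal_selection\<close>, and the quantitative form of the last step is
  \<open>banach_mazur_dist_simplex_le\<close>.
\<close>

section \<open>Norms, dual balls and polars\<close>

lemma polar_separation:
  fixes A :: "'a::euclidean_space set"
  assumes "closed A" "convex A" "0 \<in> A" "z \<notin> A"
  shows "\<exists>y. (\<forall>x\<in>A. y \<bullet> x \<le> 1) \<and> y \<bullet> z > 1"
proof -
  obtain a b where ab: "a \<bullet> z < b" "\<forall>x\<in>A. b < a \<bullet> x"
    using separating_hyperplane_closed_point[OF assms(2,1,4)] by blast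
  have "b < 0" using ab(2) assms(3) by fastforce
  then have "\<forall>x\<in>A. (a /\<^sub>R b) \<bullet> x \<le> 1" "(a /\<^sub>R b) \<bullet> z > 1"
    using ab by (auto simp: field_simps less_imp_le)
  then show ?thesis by blast
qed

text \<open>
  The index set is a set of preimages, so that the points of a contact pair stay available
  separately after the bipolar argument. Points of weight zero are dropped: only pairs of positive
  weight turn out to be contact pairs.
\<close>

lemma convex_hull_image_combination:
  fixes h :: "'a \<Rightarrow> 'b::real_vector"
  assumes "z \<in> convex hull (h ` A)"
  shows "\<exists>J w. finite J \<and> J \<subseteq> A \<and> (\<forall>j\<in>J. 0 < w j) \<and> sum w J = 1 \<and> (\<Sum>j\<in>J. w j *\<^sub>R h j) = z"
proof -
  obtain S u where S: "finite S" "S \<subseteq> h ` A" "\<forall>x\<in>S. 0 \<le> u x" "sum u S = 1"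
      "(\<Sum>v\<in>S. u v *\<^sub>R v) = z"
    using assms unfolding convex_hull_explicit by blast
  define P where "P = {x \<in> S. 0 < u x}"
  have zero: "\<forall>x\<in>S - P. u x = 0" using S(3) by (force simp: P_def)
  have sub: "P \<subseteq> S" by (auto simp: P_def)
  have "sum u P = sum u S" using zero by (intro sum.mono_neutral_left[OF S(1) sub])
  moreover have "(\<Sum>v\<in>P. u v *\<^sub>R v) = (\<Sum>v\<in>S. u v *\<^sub>R v)"
    using zero by (intro sum.mono_neutral_left[OF S(1) sub]) simp
  ultimately have P: "P \<subseteq> S" "sum u P = 1" "(\<Sum>v\<in>P. u v *\<^sub>R v) = z"
    using sub S(4,5) by simp_all
  obtain J where J: "J \<subseteq> A" "inj_on h J" "P = h ` J"
    using S(2) P(1) by (metis subset_image_inj subset_trans)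
  show ?thesis
  proof (intro exI[of _ J] exI[of _ "u \<circ> h"] conjI)
    show "finite J" using finite_subset[OF P(1) S(1)] J finite_image_iff by blast
    show "\<forall>j\<in>J. 0 < (u \<circ> h) j" using J(3) by (auto simp: P_def)
    show "sum (u \<circ> h) J = 1" using P(2) J by (simp add: sum.reindex)
    show "(\<Sum>j\<in>J. (u \<circ> h) j *\<^sub>R h j) = z" using P(3) J by (simp add: sum.reindex)
  qed (use J in auto)
qed

definition dual_unit_ball :: "(real^'n \<Rightarrow> real) \<Rightarrow> (real^'n) set" where
  "dual_unit_ball N = {u. \<forall>v. u \<bullet> v \<le> N v}"

context
  fixes N :: "real^'n \<Rightarrow> real"
  assumes N: "is_norm N"
begin

lemma is_norm_nonneg: "0 \<le> N x" and is_norm_eq_0: "N x = 0 \<longleftrightarrow> x = 0"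
  and is_norm_scale: "N (c *\<^sub>R x) = \<bar>c\<bar> * N x" and is_norm_triangle: "N (x + y) \<le> N x + N y"
  using N unfolding is_norm_def by blast+

lemma is_norm_zero: "N 0 = 0"
  using is_norm_eq_0 by blast

lemma is_norm_uminus: "N (- x) = N x"
  using is_norm_scale[of "-1" x] by simp

lemma is_norm_sum_le: "N (\<Sum>i\<in>A. f i) \<le> (\<Sum>i\<in>A. N (f i))"
proof (induction A rule: infinite_finite_induct)
  case (insert x F)
  then show ?case using is_norm_triangle[of "f x" "sum f F"] by simp
qed (auto simp: is_norm_zero)

lemma is_norm_convex_on: "convex_on UNIV N"
proof (rule convex_onI)
  fix t :: real and x y assume "0 < t" "t < 1"
  then show "N ((1 - t) *\<^sub>R x + t *\<^sub>R y) \<le> (1 - t) * N x + t * N y"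
    using is_norm_triangle[of "(1 - t) *\<^sub>R x" "t *\<^sub>R y"] by (simp add: is_norm_scale)
qed simp

lemma is_norm_continuous: "continuous_on UNIV N"
  using convex_on_continuous[OF open_UNIV is_norm_convex_on] .

lemma is_norm_lower_bound: "\<exists>m>0. \<forall>x. m * norm x \<le> N x"
proof -
  have "sphere (0::real^'n) 1 \<noteq> {}"
    by (metis empty_iff mem_sphere_0 norm_Basis SOME_Basis)
  then obtain e where e: "e \<in> sphere 0 1" "\<forall>x\<in>sphere 0 1. N e \<le> N x"
    using continuous_attains_inf[of "sphere (0::real^'n) 1" N]
      continuous_on_subset[OF is_norm_continuous subset_UNIV] compact_sphere by blast
  have pos: "N e > 0"
    using e(1) is_norm_nonneg[of e] is_norm_eq_0[of e] by (auto simp: less_le)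
  have "N e * norm x \<le> N x" for x
  proof (cases "x = 0")
    case False
    then have "x /\<^sub>R norm x \<in> sphere 0 1" by simp
    then have "N e \<le> N (x /\<^sub>R norm x)" using e(2) by blast
    then show ?thesis using False by (simp add: is_norm_scale field_simps)
  qed (simp add: is_norm_zero)
  then show ?thesis using pos by blast
qed

lemma unit_ball_closed: "closed (unit_ball N)"
  unfolding unit_ball_def
  using is_norm_continuous by (intro closed_Collect_le) auto

lemma unit_ball_compact: "compact (unit_ball N)"
proof -
  obtain m where m: "m > 0" "\<And>x. m * norm x \<le> N x"
    using is_norm_lower_bound by blast
  have "norm x \<le> 1 / m" if "x \<in> unit_ball N" for x
    using that m(2)[of x] m(1) by (simp add: unit_ball_def field_simps)
  then have "bounded (unit_ball N)" unfolding bounded_iff by blast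
  then show ?thesis using unit_ball_closed compact_eq_bounded_closed by blast
qed

lemma unit_ball_convex: "convex (unit_ball N)"
  unfolding convex_def unit_ball_def
proof clarsimp
  fix x y and u v :: real
  assume a: "N x \<le> 1" "N y \<le> 1" "0 \<le> u" "0 \<le> v" "u + v = 1"
  have "N (u *\<^sub>R x + v *\<^sub>R y) \<le> u * N x + v * N y"
    using is_norm_triangle[of "u *\<^sub>R x" "v *\<^sub>R y"] a by (simp add: is_norm_scale)
  also have "\<dots> \<le> u * 1 + v * 1" using a by (intro add_mono mult_left_mono)
  finally show "N (u *\<^sub>R x + v *\<^sub>R y) \<le> 1" using a by simp
qed

lemma zero_in_unit_ball: "0 \<in> unit_ball N"
  by (simp add: unit_ball_def is_norm_zero)

lemma unit_ball_contains_cball: "\<exists>r>0. cball 0 r \<subseteq> unit_ball N"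
proof -
  have "open {x. N x < 1}" using is_norm_continuous by (intro open_Collect_less) auto
  moreover have "0 \<in> {x. N x < 1}" by (simp add: is_norm_zero)
  ultimately obtain r where "r > 0" "cball 0 r \<subseteq> {x. N x < 1}"
    using open_contains_cball by blast
  then show ?thesis unfolding unit_ball_def by (intro exI[of _ r]) auto
qed

lemma dual_unit_ball_iff: "u \<in> dual_unit_ball N \<longleftrightarrow> (\<forall>x\<in>unit_ball N. u \<bullet> x \<le> 1)"
proof
  assume "u \<in> dual_unit_ball N"
  then show "\<forall>x\<in>unit_ball N. u \<bullet> x \<le> 1"
    unfolding dual_unit_ball_def unit_ball_def by (auto intro: order_trans)
next
  assume L: "\<forall>x\<in>unit_ball N. u \<bullet> x \<le> 1"
  have "u \<bullet> v \<le> N v" for v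
  proof (cases "v = 0")
    case False
    then have "N v > 0" using is_norm_nonneg is_norm_eq_0 by (metis less_eq_real_def)
    moreover from this have "v /\<^sub>R N v \<in> unit_ball N"
      by (simp add: unit_ball_def is_norm_scale)
    ultimately show ?thesis using L by (fastforce simp: field_simps)
  qed (simp add: is_norm_zero)
  then show "u \<in> dual_unit_ball N" by (simp add: dual_unit_ball_def)
qed

text \<open>
  By the bipolar theorem: a vector outside a multiple of the unit ball is separated from it by a
  functional which, suitably scaled, belongs to the dual ball.
\<close>

lemma is_norm_le_if_dual_le:
  assumes "\<And>u. u \<in> dual_unit_ball N \<Longrightarrow> u \<bullet> v \<le> \<alpha>"
  shows "N v \<le> \<alpha>"
proof (rule ccontr)
  assume "\<not> N v \<le> \<alpha>"
  then obtain \<beta> where b: "\<alpha> < \<beta>" "\<beta> < N v" using dense not_le by blast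
  have "0 \<in> dual_unit_ball N" by (simp add: dual_unit_ball_def is_norm_nonneg)
  then have "\<alpha> \<ge> 0" using assms by fastforce
  then have "\<beta> > 0" using b by simp
  then have "v /\<^sub>R \<beta> \<notin> unit_ball N"
    using b by (simp add: unit_ball_def is_norm_scale field_simps)
  then obtain y where y: "\<forall>x\<in>unit_ball N. y \<bullet> x \<le> 1" "y \<bullet> (v /\<^sub>R \<beta>) > 1"
    using polar_separation[OF unit_ball_closed unit_ball_convex zero_in_unit_ball] by blast
  then have "y \<in> dual_unit_ball N" using dual_unit_ball_iff by blast
  moreover have "y \<bullet> v > \<beta>" using y(2) \<open>\<beta> > 0\<close> by (simp add: field_simps)
  ultimately show False using assms b by fastforce
qed

lemma dual_unit_ball_abs: "u \<in> dual_unit_ball N \<Longrightarrow> \<bar>u \<bullet> v\<bar> \<le> N v"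
  unfolding dual_unit_ball_def using is_norm_uminus[of v]
  by (metis (mono_tags) abs_le_iff inner_minus_right mem_Collect_eq)

lemma polar_compact:
  assumes "unit_ball N \<subseteq> K"
  shows "compact {y. \<forall>x\<in>K. y \<bullet> x \<le> 1}"
proof -
  obtain r where r: "r > 0" "cball 0 r \<subseteq> unit_ball N" using unit_ball_contains_cball by blast
  have "norm y \<le> 1 / r" if "\<forall>x\<in>K. y \<bullet> x \<le> 1" for y
  proof (cases "y = 0")
    case False
    have "(r / norm y) *\<^sub>R y \<in> cball 0 r" using r False by simp
    then have "y \<bullet> ((r / norm y) *\<^sub>R y) \<le> 1" using that r assms by blast
    then show ?thesis using False r by (simp add: field_simps power2_norm_eq_inner[symmetric] power2_eq_square)
  qed (use r in simp)
  then have "bounded {y. \<forall>x\<in>K. y \<bullet> x \<le> 1}" unfolding bounded_iff by blast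
  moreover have "closed {y. \<forall>x\<in>K. y \<bullet> x \<le> 1}"
    unfolding Ball_def by (intro closed_Collect_all closed_Collect_imp open_Collect_const
        closed_Collect_le continuous_intros)
  ultimately show ?thesis using compact_eq_bounded_closed by blast
qed

lemma dual_unit_ball_compact: "compact (dual_unit_ball N)"
proof -
  have "dual_unit_ball N = {y. \<forall>x\<in>unit_ball N. y \<bullet> x \<le> 1}" using dual_unit_ball_iff by auto
  then show ?thesis using polar_compact[of "unit_ball N"] by simp
qed

end

section \<open>Affine images of maximal volume and contact pairs\<close>

text \<open>
  The matrix of \<open>v \<mapsto> (x \<bullet> v) y\<close>. Its inner product with \<open>A\<close> is \<open>y \<bullet> A x\<close>, so a constraint
  \<open>y \<bullet> (A x + b) \<le> 1\<close> on an affine map is a half-space in the space of pairs \<open>(A, b)\<close>.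
\<close>

definition outer_product :: "real^'n \<Rightarrow> real^'n \<Rightarrow> real^'n^'n" where
  "outer_product y x = (\<chi> i j. y $ i * x $ j)"

lemma inner_outer_product: "A \<bullet> outer_product y x = y \<bullet> (A *v x)"
  unfolding outer_product_def inner_vec_def matrix_vector_mult_def
  by (simp add: sum_distrib_left mult_ac)

lemma outer_product_mult: "outer_product y x *v v = (x \<bullet> v) *\<^sub>R y"
  unfolding outer_product_def inner_vec_def matrix_vector_mult_def
  by (simp add: vec_eq_iff sum_distrib_left mult_ac)

lemma inner_mat_1: "A \<bullet> mat 1 = (\<Sum>i\<in>UNIV. A $ i $ i)" for A :: "real^'n^'n"
  unfolding inner_vec_def mat_def
  by (simp add: if_distrib cong: if_cong)

text \<open>
  In the Leibniz formula a permutation other than the identity moves at least two indices, so its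
  product vanishes to second order at the identity matrix; only the diagonal product contributes.
\<close>

lemma deriv_det_at_mat_1:
  fixes A :: "real^'n^'n"
  shows "((\<lambda>t. det (mat 1 + t *\<^sub>R A)) has_real_derivative (\<Sum>i\<in>UNIV. A $ i $ i)) (at 0)"
proof -
  have D: "((\<lambda>t. of_int (sign p) * (\<Prod>i\<in>UNIV. (mat 1 + t *\<^sub>R A) $ i $ p i))
      has_real_derivative (if p = id then \<Sum>i\<in>UNIV. A $ i $ i else 0)) (at 0)"
    if p: "p permutes UNIV" for p :: "'n \<Rightarrow> 'n"
  proof -
    let ?f = "\<lambda>i t. (mat 1 + t *\<^sub>R A) $ i $ p i"
    have "((\<lambda>t. \<Prod>i\<in>UNIV. ?f i t) has_real_derivative
        (\<Sum>i\<in>UNIV. A $ i $ p i * (\<Prod>j\<in>UNIV - {i}. ?f j 0))) (at 0)"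
      by (rule has_field_derivative_prod) (auto intro!: derivative_eq_intros)
    moreover have "(\<Prod>j\<in>UNIV - {i}. ?f j 0) = (if p = id then 1 else 0)" for i
    proof (cases "p = id")
      case False
      then obtain j where j: "p j \<noteq> j" by fastforce
      then have "p (p j) \<noteq> p j" using permutes_inj[OF p] by (metis injD)
      then obtain k where "k \<noteq> i" "p k \<noteq> k" using j by metis
      then show ?thesis using False by (auto simp: mat_def intro!: prod_zero bexI[of _ k])
    qed (simp add: mat_def)
    ultimately have E: "((\<lambda>t. \<Prod>i\<in>UNIV. ?f i t) has_real_derivative
        (\<Sum>i\<in>UNIV. A $ i $ p i * (if p = id then 1 else 0))) (at 0)"
      by simp
    show ?thesis
      using DERIV_cmult[OF E, of "of_int (sign p)"] by (cases "p = id") (auto simp: sign_id id_def[symmetric])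
  qed
  have "((\<lambda>t. \<Sum>p\<in>{p. p permutes UNIV}. of_int (sign p) * (\<Prod>i\<in>UNIV. (mat 1 + t *\<^sub>R A) $ i $ p i))
      has_real_derivative (\<Sum>p\<in>{p. p permutes (UNIV::'n set)}. if p = id then \<Sum>i\<in>UNIV. A $ i $ i else 0)) (at 0)"
    by (rule DERIV_sum) (use D in auto)
  moreover have "(\<Sum>p\<in>{p. p permutes (UNIV::'n set)}. if p = id then \<Sum>i\<in>UNIV. A $ i $ i else 0)
      = (\<Sum>i\<in>UNIV. A $ i $ i)"
    by (simp add: sum.delta finite_permutations permutes_id)
  ultimately show ?thesis unfolding det_def by simp
qed

text \<open>
  The affine maps sending \<open>B\<close> into \<open>K\<close> form a convex set. If the identity maximises the determinant
  on it, then the derivative of the determinant along a segment leaving the identity, which is a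
  trace, cannot be positive.
\<close>

lemma trace_le_of_det_max:
  fixes K :: "(real^'n) set" and A :: "real^'n^'n"
  assumes "convex K" "B \<subseteq> K"
    and max: "\<forall>A b. (\<forall>x\<in>B. A *v x + b \<in> K) \<longrightarrow> det A \<le> 1"
    and A: "\<forall>x\<in>B. A *v x + b \<in> K"
  shows "(\<Sum>i\<in>UNIV. A $ i $ i) \<le> CARD('n)"
proof (rule ccontr)
  assume "\<not> ?thesis"
  then have "(\<Sum>i\<in>UNIV. (A - mat 1) $ i $ i) > 0"
    by (simp add: mat_def sum_subtractf)
  from DERIV_pos_inc_right[OF deriv_det_at_mat_1 this]
  obtain d where d: "d > 0" "\<And>h. 0 < h \<Longrightarrow> h < d \<Longrightarrow> 1 < det (mat 1 + h *\<^sub>R (A - mat 1))"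
    by auto
  define h where "h = min (d / 2) 1"
  have h: "0 < h" "h < d" "h \<le> 1" using d(1) by (auto simp: h_def)
  have "(mat 1 + h *\<^sub>R (A - mat 1)) *v x + h *\<^sub>R b \<in> K" if "x \<in> B" for x
  proof -
    have "(mat 1 + h *\<^sub>R (A - mat 1)) *v x + h *\<^sub>R b = (1 - h) *\<^sub>R x + h *\<^sub>R (A *v x + b)"
      by (simp add: matrix_vector_mult_add_rdistrib matrix_vector_mult_diff_rdistrib
          scaleR_matrix_vector_assoc[symmetric] algebra_simps)
    then show ?thesis
      using convexD[OF \<open>convex K\<close>, of x "A *v x + b" "1 - h" h] that h A \<open>B \<subseteq> K\<close> by auto
  qed
  then have "det (mat 1 + h *\<^sub>R (A - mat 1)) \<le> 1" using max by blast
  then show False using d(2)[OF h(1,2)] by simp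
qed

text \<open>
  The trace inequality says that the functional \<open>(A, b) \<mapsto> tr A / n\<close> is at most 1 on a convex set cut
  out by the constraints \<open>y \<bullet> (A x + b) \<le> 1\<close>, for \<open>x\<close> in the ball and \<open>y\<close> in the polar of \<open>K\<close>. By the
  bipolar theorem this functional is a convex combination of the constraints. Comparing traces
  forces \<open>y \<bullet> x = 1\<close> in each constraint used, so that the pairs are contact pairs of the ball and \<open>K\<close>.
\<close>

lemma john_decomposition:
  fixes N :: "real^'n \<Rightarrow> real" and K :: "(real^'n) set"
  assumes N: "is_norm N" and K: "convex K" "closed K" "unit_ball N \<subseteq> K"
    and max: "\<forall>A b. (\<forall>x\<in>unit_ball N. A *v x + b \<in> K) \<longrightarrow> det A \<le> 1"
  shows "\<exists>J w. finite J \<and> (\<forall>j\<in>J. 0 < w j) \<and> sum w J = 1 \<and>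
    (\<forall>j\<in>J. N (fst j) = 1 \<and> snd j \<in> dual_unit_ball N \<and> snd j \<bullet> fst j = 1 \<and> (\<forall>z\<in>K. snd j \<bullet> z \<le> 1)) \<and>
    (\<Sum>j\<in>J. w j *\<^sub>R snd j) = 0 \<and>
    (\<forall>v. real CARD('n) *\<^sub>R (\<Sum>j\<in>J. (w j * (snd j \<bullet> v)) *\<^sub>R fst j) = v)"
proof -
  define P where "P = {y. \<forall>z\<in>K. y \<bullet> z \<le> 1}"
  define h :: "(real^'n) \<times> (real^'n) \<Rightarrow> (real^'n^'n) \<times> (real^'n)"
    where "h = (\<lambda>(x, y). (outer_product y x, y))"
  let ?G = "convex hull (h ` (unit_ball N \<times> P))"
  have K0: "0 \<in> K" using zero_in_unit_ball[OF N] K by auto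
  have "continuous_on UNIV h"
    unfolding h_def outer_product_def case_prod_beta by (intro continuous_intros)
  then have "compact (h ` (unit_ball N \<times> P))"
    using unit_ball_compact[OF N] polar_compact[OF N K(3)] unfolding P_def
    by (intro compact_continuous_image compact_Times) (auto intro: continuous_on_subset)
  then have cl: "closed ?G" by (intro compact_imp_closed compact_convex_hull)
  have "h (0, 0) = (0, 0)" by (simp add: h_def outer_product_def vec_eq_iff zero_vec_def)
  moreover have "(0, 0) \<in> unit_ball N \<times> P" using zero_in_unit_ball[OF N] by (simp add: P_def)
  ultimately have G0: "0 \<in> ?G" by (metis hull_inc imageI zero_prod_def)
  have "((1 / CARD('n)) *\<^sub>R mat 1, 0) \<in> ?G"
  proof (rule ccontr)
    assume "\<not> ?thesis"
    then obtain a where a: "\<And>g. g \<in> ?G \<Longrightarrow> a \<bullet> g \<le> 1" "a \<bullet> ((1 / CARD('n)) *\<^sub>R mat 1, 0) > 1"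
      using polar_separation[OF cl convex_convex_hull G0] by blast
    obtain A b where ab: "a = (A, b)" by (cases a)
    have "A *v x + b \<in> K" if x: "x \<in> unit_ball N" for x
    proof (rule ccontr)
      assume "A *v x + b \<notin> K"
      then obtain y where y: "\<forall>z\<in>K. y \<bullet> z \<le> 1" "y \<bullet> (A *v x + b) > 1"
        using polar_separation[OF K(2,1) K0] by blast
      then have "h (x, y) \<in> ?G" using x by (intro hull_inc imageI) (simp add: P_def)
      then show False using a(1)[of "h (x, y)"] y(2)
        by (simp add: h_def ab inner_outer_product inner_right_distrib inner_commute)
    qed
    then have "(\<Sum>i\<in>UNIV. A $ i $ i) \<le> CARD('n)"
      by (intro trace_le_of_det_max[OF K(1,3) max, of A b] ballI)
    then show False using a(2) by (simp add: ab inner_mat_1 field_simps)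
  qed
  from convex_hull_image_combination[OF this]
  obtain J w where J: "finite J" "J \<subseteq> unit_ball N \<times> P" "\<forall>j\<in>J. 0 < w j" "sum w J = 1"
      and S: "(\<Sum>j\<in>J. w j *\<^sub>R h j) = ((1 / CARD('n)) *\<^sub>R mat 1, 0)"
    by (elim exE conjE)
  have S1: "(\<Sum>j\<in>J. w j *\<^sub>R outer_product (snd j) (fst j)) = (1 / CARD('n)) *\<^sub>R mat 1"
    using arg_cong[OF S, of fst] by (simp add: fst_sum h_def case_prod_beta)
  have S2: "(\<Sum>j\<in>J. w j *\<^sub>R snd j) = 0"
    using arg_cong[OF S, of snd] by (simp add: snd_sum h_def case_prod_beta)
  have T: "real CARD('n) *\<^sub>R (\<Sum>j\<in>J. (w j * (snd j \<bullet> v)) *\<^sub>R fst j) = v" for v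
  proof -
    have "transpose (\<Sum>j\<in>J. w j *\<^sub>R outer_product (snd j) (fst j)) = (1 / CARD('n)) *\<^sub>R (mat 1 :: real^'n^'n)"
      unfolding S1 by (simp add: transpose_def mat_def vec_eq_iff)
    moreover have "transpose (\<Sum>j\<in>J. w j *\<^sub>R outer_product (snd j) (fst j)) = (\<Sum>j\<in>J. w j *\<^sub>R outer_product (fst j) (snd j))"
      by (simp add: transpose_def outer_product_def vec_eq_iff mult.commute)
    ultimately have "(\<Sum>j\<in>J. w j *\<^sub>R outer_product (fst j) (snd j)) *v v = (1 / CARD('n)) *\<^sub>R v"
      by (simp add: scaleR_matrix_vector_assoc[symmetric])
    moreover have "(\<Sum>j\<in>J. w j *\<^sub>R outer_product (fst j) (snd j)) *v v = (\<Sum>j\<in>J. (w j * (snd j \<bullet> v)) *\<^sub>R fst j)"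
      using J(1) by (induction J rule: finite_induct)
       (simp_all add: matrix_vector_mult_add_rdistrib scaleR_matrix_vector_assoc[symmetric] outer_product_mult)
    ultimately show ?thesis by simp
  qed
  have polar: "\<forall>z\<in>K. snd j \<bullet> z \<le> 1" and ball: "fst j \<in> unit_ball N" if "j \<in> J" for j
    using J(2) that by (auto simp: P_def)
  have dual: "snd j \<in> dual_unit_ball N" if "j \<in> J" for j
    using polar[OF that] K(3) dual_unit_ball_iff[OF N] by blast
  have le1: "snd j \<bullet> fst j \<le> 1" if "j \<in> J" for j
    using polar[OF that] ball[OF that] K(3) by blast
  have "(\<Sum>j\<in>J. w j * (snd j \<bullet> fst j)) = mat 1 \<bullet> (\<Sum>j\<in>J. w j *\<^sub>R outer_product (snd j) (fst j))"
    by (simp add: inner_sum_right inner_outer_product)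
  also have "\<dots> = 1"
    unfolding S1 inner_scaleR_right inner_mat_1 by (simp add: mat_def)
  finally have "(\<Sum>j\<in>J. w j * (1 - snd j \<bullet> fst j)) = 0"
    using J(4) by (simp add: right_diff_distrib sum_subtractf)
  then have "\<forall>j\<in>J. w j * (1 - snd j \<bullet> fst j) = 0"
    using J(1,3) le1 by (subst (asm) sum_nonneg_eq_0_iff) (auto intro: less_imp_le)
  then have eq1: "snd j \<bullet> fst j = 1" if "j \<in> J" for j
    using J(3) that by fastforce
  have N1: "N (fst j) = 1" if "j \<in> J" for j
    using dual_unit_ball_abs[OF N dual[OF that], of "fst j"] eq1[OF that] ball[OF that]
    by (simp add: unit_ball_def)
  show ?thesis
    by (intro exI[of _ J] exI[of _ w] conjI ballI allI J(1,3,4) S2 T)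
      (use polar dual eq1 N1 in auto)
qed

text \<open>
  The affine maps sending the ball into \<open>K\<close> form a compact set, so the determinant attains its
  maximum; it is positive because \<open>K\<close> contains a small homothetic copy of the ball.
\<close>

lemma max_volume_position:
  fixes N :: "real^'n \<Rightarrow> real" and K :: "(real^'n) set"
  assumes N: "is_norm N" and K: "convex_body K"
  shows "\<exists>T b. det T > 0 \<and> (\<forall>x\<in>unit_ball N. T *v x + b \<in> K) \<and>
    (\<forall>A c. (\<forall>x\<in>unit_ball N. A *v x + c \<in> K) \<longrightarrow> det A \<le> det T)"
proof -
  let ?B = "unit_ball N"
  define E where "E = {(T :: real^'n^'n, b). \<forall>x\<in>?B. T *v x + b \<in> K}"
  have comp: "compact K" using K by (simp add: convex_body_def)
  obtain M where M: "\<And>z. z \<in> K \<Longrightarrow> norm z \<le> M" "M > 0"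
    using compact_imp_bounded[OF comp] bounded_pos by blast
  obtain r where r: "r > 0" "cball 0 r \<subseteq> ?B" using unit_ball_contains_cball[OF N] by blast
  have "E = (\<Inter>x\<in>?B. (\<lambda>z. fst z *v x + snd z) -` K)" by (auto simp: E_def)
  moreover have "closed ((\<lambda>z. fst z *v x + snd z) -` K)" for x
    by (intro closed_vimage compact_imp_closed comp)
      (auto simp: matrix_vector_mult_def intro!: continuous_intros)
  ultimately have "closed E" by auto
  moreover have "bounded E"
  proof -
    have "norm z \<le> (\<Sum>i\<in>(UNIV::'n set). \<Sum>j\<in>(UNIV::'n set). 2 * M / r) + M" if "z \<in> E" for z
    proof -
      obtain T b where z: "z = (T, b)" by (cases z)
      have zE: "\<And>x. x \<in> ?B \<Longrightarrow> T *v x + b \<in> K" using that by (auto simp: E_def z)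
      have b: "norm b \<le> M" using zE[OF zero_in_unit_ball[OF N]] M(1) by simp
      have "\<bar>T $ i $ j\<bar> \<le> 2 * M / r" for i j
      proof -
        have "r *\<^sub>R axis j 1 \<in> ?B" using r by (intro subsetD[OF r(2)]) simp
        then have "norm (T *v (r *\<^sub>R axis j 1) + b) \<le> M" using zE M(1) by blast
        then have "norm (T *v (r *\<^sub>R axis j 1)) \<le> 2 * M"
          using norm_triangle_ineq4[of "T *v (r *\<^sub>R axis j 1) + b" b] b by simp
        moreover have "(T *v (r *\<^sub>R axis j 1)) $ i = r * T $ i $ j"
          by (simp add: matrix_vector_mult_basis column_def matrix_vector_mult_scaleR)
        ultimately have "\<bar>r * T $ i $ j\<bar> \<le> 2 * M" by (metis component_le_norm_cart order_trans)
        then show ?thesis using r by (simp add: abs_mult field_simps)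
      qed
      then have "(\<Sum>i\<in>UNIV. \<Sum>j\<in>UNIV. \<bar>T $ i $ j\<bar>) \<le> (\<Sum>i\<in>(UNIV::'n set). \<Sum>j\<in>(UNIV::'n set). 2 * M / r)"
        by (intro sum_mono)
      moreover have "norm T \<le> (\<Sum>i\<in>UNIV. norm (T $ i))"
        unfolding norm_vec_def by (rule L2_set_le_sum) simp
      moreover have "(\<Sum>i\<in>UNIV. norm (T $ i)) \<le> (\<Sum>i\<in>UNIV. \<Sum>j\<in>UNIV. \<bar>T $ i $ j\<bar>)"
        by (intro sum_mono norm_le_l1_cart)
      moreover have "norm z \<le> norm T + norm b" unfolding z by (rule norm_Pair_le)
      ultimately show ?thesis using b by linarith
    qed
    then show ?thesis unfolding bounded_iff by blast
  qed
  ultimately have cE: "compact E" using compact_eq_bounded_closed by blast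
  have "interior K \<noteq> {}" using K by (simp add: convex_body_def)
  then obtain z e where e: "e > 0" "cball z e \<subseteq> K" by (meson ex_in_conv mem_interior_cball)
  obtain L where L: "\<And>x. x \<in> ?B \<Longrightarrow> norm x \<le> L" "L > 0"
    using compact_imp_bounded[OF unit_ball_compact[OF N]] bounded_pos by blast
  let ?T = "(e / L) *\<^sub>R (mat 1 :: real^'n^'n)"
  have T0: "(?T, z) \<in> E"
  proof -
    have "?T *v x + z \<in> K" if "x \<in> ?B" for x
    proof -
      have "e / L * norm x \<le> e / L * L" using L that e by (intro mult_left_mono) auto
      then have "(e / L) *\<^sub>R x + z \<in> cball z e" using L e by (simp add: dist_norm)
      then show ?thesis using e by (auto simp: scaleR_matrix_vector_assoc[symmetric])
    qed
    then show ?thesis by (simp add: E_def)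
  qed
  have "det ?T = (\<Prod>i\<in>(UNIV::'n set). ?T $ i $ i)" by (rule det_diagonal) (simp add: mat_def)
  then have dT0: "det ?T > 0" using e L by (simp add: mat_def)
  have "continuous_on E (\<lambda>z. det (fst z))"
    unfolding det_def by (intro continuous_intros)
  then obtain m where m: "m \<in> E" "\<And>z. z \<in> E \<Longrightarrow> det (fst z) \<le> det (fst m)"
    using continuous_attains_sup[OF cE] T0 by blast
  show ?thesis
  proof (intro exI conjI allI impI)
    show "det (fst m) > 0" using m(2)[OF T0] dT0 by simp
    show "\<forall>x\<in>?B. fst m *v x + snd m \<in> K" using m(1) by (auto simp: E_def)
    show "det A \<le> det (fst m)" if "\<forall>x\<in>?B. A *v x + c \<in> K" for A c
      using m(2)[of "(A, c)"] that by (simp add: E_def)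
  qed
qed

text \<open>
  Pulling \<open>K\<close> back along the maximal affine map turns that map into the identity.
\<close>

lemma normalized_maximal_position:
  fixes N :: "real^'n \<Rightarrow> real" and K :: "(real^'n) set"
  assumes N: "is_norm N" and K: "convex_body K"
  shows "\<exists>T b K'. linear T \<and> bij T \<and> K = (\<lambda>x. T x + b) ` K' \<and> compact K' \<and> convex K' \<and>
    unit_ball N \<subseteq> K' \<and> (\<forall>A c. (\<forall>x\<in>unit_ball N. A *v x + c \<in> K') \<longrightarrow> det A \<le> 1)"
proof -
  obtain T b where T: "det T > 0" "\<forall>x\<in>unit_ball N. T *v x + b \<in> K"
    "\<forall>A c. (\<forall>x\<in>unit_ball N. A *v x + c \<in> K) \<longrightarrow> det A \<le> det T"
    using max_volume_position[OF N K] by (elim exE conjE)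
  define K' where "K' = {z. T *v z + b \<in> K}"
  have inv: "invertible T" using T(1) invertible_det_nz[of T] by auto
  then have bij: "bij ((*v) T)" by (simp add: invertible_eq_bij)
  obtain S where "T ** S = mat 1" "S ** T = mat 1" using inv by (auto simp: invertible_def)
  then have TS: "T *v (S *v z) = z" and ST: "S *v (T *v z) = z" for z
    by (simp_all add: matrix_vector_mul_assoc)
  have K: "compact K" "convex K" using assms by (auto simp: convex_body_def)
  have K'_eq: "K' = (\<lambda>x. S *v (x - b)) ` K"
  proof
    show "K' \<subseteq> (\<lambda>x. S *v (x - b)) ` K"
    proof
      fix z assume "z \<in> K'"
      then show "z \<in> (\<lambda>x. S *v (x - b)) ` K"
        by (intro image_eqI[of _ _ "T *v z + b"]) (simp_all add: K'_def ST)
    qed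
  qed (auto simp: K'_def TS)
  show ?thesis
  proof (intro exI conjI allI impI)
    show "linear ((*v) T)" "bij ((*v) T)" using bij by simp_all
    show "K = (\<lambda>x. T *v x + b) ` K'" unfolding K'_eq by (simp add: image_image TS)
    have "continuous_on K (\<lambda>x. S *v (x - b))"
      unfolding matrix_vector_mult_def by (intro continuous_intros)
    then show "compact K'" unfolding K'_eq by (intro compact_continuous_image K)
    show "convex K'"
      unfolding K'_def convex_def
    proof clarsimp
      fix x y and u v :: real
      assume a: "T *v x + b \<in> K" "T *v y + b \<in> K" "0 \<le> u" "0 \<le> v" "u + v = 1"
      have "u *\<^sub>R (T *v x + b) + v *\<^sub>R (T *v y + b) = T *v (u *\<^sub>R x + v *\<^sub>R y) + (u + v) *\<^sub>R b"
        by (simp add: matrix_vector_right_distrib matrix_vector_mult_scaleR algebra_simps)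
      then show "T *v (u *\<^sub>R x + v *\<^sub>R y) + b \<in> K"
        using convexD[OF K(2) a] a(5) by simp
    qed
    show "unit_ball N \<subseteq> K'" using T(2) by (auto simp: K'_def)
    show "det A \<le> 1" if A: "\<forall>x\<in>unit_ball N. A *v x + c \<in> K'" for A c
    proof -
      have "(T ** A) *v x + (T *v c + b) \<in> K" if "x \<in> unit_ball N" for x
        using A that by (simp add: K'_def matrix_vector_right_distrib matrix_vector_mul_assoc add.assoc)
      then have "det (T ** A) \<le> det T" using T(3) by blast
      then show ?thesis using T(1) by (simp add: det_mul)
    qed
  qed
qed

section \<open>Banach-Mazur distance and simplices\<close>

lemma banach_mazur_dist_le:
  assumes "0 < r" "linear T" "bij T"
    "(+) u ` K \<subseteq> T ` ((+) v ` L)" "T ` ((+) v ` L) \<subseteq> (*\<^sub>R) r ` ((+) u ` K)"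
  shows "banach_mazur_dist K L \<le> r"
  unfolding banach_mazur_dist_def
proof (rule cInf_lower)
  show "bdd_below {r. 0 < r \<and> (\<exists>T u v. linear T \<and> bij T \<and>
          (+) u ` K \<subseteq> T ` ((+) v ` L) \<and> T ` ((+) v ` L) \<subseteq> (*\<^sub>R) r ` ((+) u ` K))}"
    by (rule bdd_belowI[of _ 0]) auto
qed (use assms in blast)

text \<open>
  The definition of the distance compares \<open>K\<close> with a copy enlarged about the origin. Here the
  enlargement is about an arbitrary centre \<open>c\<close>, and \<open>K\<close> may first be moved by an affine map, so bodies can
  be studied in whichever affine position is convenient.
\<close>

lemma banach_mazur_dist_le_sandwich:
  fixes K L :: "(real^'n) set" and A B :: "real^'n \<Rightarrow> real^'n"
  assumes A: "linear A" "bij A" and B: "linear B" "bij B" and r: "0 < r"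
    and in1: "(\<lambda>x. B x + b) ` L \<subseteq> K" and in2: "K \<subseteq> (\<lambda>x. c + r *\<^sub>R (B x + b - c)) ` L"
  shows "banach_mazur_dist ((\<lambda>x. A x + a) ` K) L \<le> r"
proof (rule banach_mazur_dist_le[OF r])
  let ?T = "\<lambda>x. r *\<^sub>R A (B x)"
  let ?u = "- (A c + a)"
  let ?v = "inv B (b - c)"
  have lin: "A (x + y) = A x + A y" "A (x - y) = A x - A y" "A (r *\<^sub>R x) = r *\<^sub>R A x"
    "B (x + y) = B x + B y" for x y
    using A(1) B(1) linear_add linear_diff linear_scale by metis+
  have Bv: "B ?v = b - c" using B(2) by (simp add: bij_is_surj surj_f_inv_f)
  have T: "?T (?v + x) = r *\<^sub>R (A (B x + b) - A c)" for x
    by (simp add: lin Bv algebra_simps)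
  show "linear ?T"
    using linear_compose_scale_right[OF linear_compose[OF B(1) A(1)], of r] by (simp add: o_def)
  have "?T = (\<lambda>x. r *\<^sub>R x) \<circ> (A \<circ> B)" by auto
  moreover have "bij (\<lambda>x::real^'n. r *\<^sub>R x)"
    using r by (intro o_bij[of "\<lambda>x. x /\<^sub>R r"]) auto
  ultimately show "bij ?T" using A(2) B(2) by (metis bij_comp)
  show "(+) ?u ` ((\<lambda>x. A x + a) ` K) \<subseteq> ?T ` ((+) ?v ` L)"
  proof clarify
    fix x assume "x \<in> K"
    then obtain z where z: "z \<in> L" "x = c + r *\<^sub>R (B z + b - c)" using in2 by blast
    then have "- (A c + a) + (A x + a) = ?T (?v + z)" by (simp only: T) (simp add: lin)
    then show "- (A c + a) + (A x + a) \<in> ?T ` ((+) ?v ` L)" using z(1) by blast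
  qed
  show "?T ` ((+) ?v ` L) \<subseteq> (*\<^sub>R) r ` ((+) ?u ` ((\<lambda>x. A x + a) ` K))"
  proof clarify
    fix z assume "z \<in> L"
    then have "B z + b \<in> K" using in1 by blast
    moreover have "?T (?v + z) = r *\<^sub>R (?u + (A (B z + b) + a))" by (simp add: T)
    ultimately show "?T (?v + z) \<in> (*\<^sub>R) r ` ((+) ?u ` ((\<lambda>x. A x + a) ` K))" by blast
  qed
qed

lemma simplices_affinely_equivalent:
  fixes V W :: "(real^'n) set"
  assumes V: "\<not> affine_dependent V" "card V = CARD('n) + 1"
    and W: "\<not> affine_dependent W" "card W = CARD('n) + 1"
  obtains B b where "linear B" "bij B" "(\<lambda>x. B x + b) ` (convex hull V) = convex hull W"
proof -
  obtain v where v: "v \<in> V" using V(2) by fastforce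
  obtain w where w: "w \<in> W" using W(2) by fastforce
  let ?V = "(\<lambda>x. x - v) ` (V - {v})" and ?W = "(\<lambda>x. x - w) ` (W - {w})"
  have fin: "finite V" "finite W" using V(2) W(2) card.infinite by fastforce+
  have "independent ?V"
    using V(1) affine_dependent_iff_dependent2[OF v] by (simp add: algebra_simps)
  have "independent ?W"
    using W(1) affine_dependent_iff_dependent2[OF w] by (simp add: algebra_simps)
  have card: "card ?V = CARD('n)" "card ?W = CARD('n)"
    using V(2) W(2) fin v w by (simp_all add: card_image inj_on_def)
  then obtain g where g: "bij_betw g ?V ?W"
    using fin by (metis finite_Diff finite_imageI finite_same_card_bij)
  obtain B where B: "linear B" "\<forall>x\<in>?V. B x = g x"
    using linear_independent_extend[OF \<open>independent ?V\<close>] by blast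
  have img: "B ` ?V = ?W" using B(2) g by (metis bij_betw_imp_surj_on image_cong)
  have "span ?W = UNIV"
    using \<open>independent ?W\<close> card(2) fin by (intro card_ge_dim_independent[THEN subset_antisym, of _ UNIV, simplified, THEN sym]) auto
  then have "surj B" using img B(1) by (metis linear_span_image UNIV_I subsetI span_UNIV image_mono subset_antisym top_greatest)
  then have bij: "bij B" using B(1) linear_surjective_imp_injective by (auto simp: bij_def)
  have "(\<lambda>x. x - v) ` V = insert 0 ?V" "(\<lambda>x. x - w) ` W = insert 0 ?W" using v w by auto
  then have "B ` ((\<lambda>x. x - v) ` V) = (\<lambda>x. x - w) ` W" using img linear_0[OF B(1)] by auto
  then have "(\<lambda>x. x + w) ` (B ` ((\<lambda>x. x - v) ` V)) = W" by (simp add: image_image)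
  then have *: "(\<lambda>x. B x + (w - B v)) ` V = W"
    by (simp add: image_image linear_diff[OF B(1)] algebra_simps)
  have "(\<lambda>x. B x + (w - B v)) ` (convex hull V) = (\<lambda>x. (w - B v) + x) ` (B ` (convex hull V))"
    by (simp add: image_image add.commute)
  also have "\<dots> = convex hull ((\<lambda>x. (w - B v) + x) ` (B ` V))"
    by (simp only: convex_hull_linear_image[OF B(1)] convex_hull_translation)
  also have "\<dots> = convex hull W" using * by (simp add: image_image add.commute)
  finally show ?thesis using that[OF B(1) bij] by blast
qed

text \<open>
  The numbers \<open>1 - Y k \<bullet> X l\<close> form an almost diagonal matrix: the point \<open>X l\<close> of \<open>K\<close> is nearly a common
  point of all supporting hyperplanes \<open>Y k = 1\<close> with \<open>k \<noteq> l\<close>. A point of \<open>K\<close> satisfies all the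
  inequalities \<open>Y k \<le> 1\<close>; written in barycentric coordinates of the points \<open>X\<close>, they bound its
  coordinates from below by a small negative number. So \<open>K\<close> lies between the simplex with vertices
  \<open>X\<close> and a copy of it slightly enlarged about its centroid.
\<close>

lemma banach_mazur_dist_simplex_le:
  fixes K S :: "(real^'n) set" and X Y :: "'k \<Rightarrow> real^'n" and \<tau> f :: real
  assumes S: "regular_simplex S" and A: "linear A" "bij A"
    and K: "convex K" and Q: "finite Q" "card Q = CARD('n) + 1"
    and X: "\<And>k. k \<in> Q \<Longrightarrow> X k \<in> K"
    and Y: "\<And>k z. k \<in> Q \<Longrightarrow> z \<in> K \<Longrightarrow> Y k \<bullet> z \<le> 1"
    and off: "\<And>k l. k \<in> Q \<Longrightarrow> l \<in> Q \<Longrightarrow> k \<noteq> l \<Longrightarrow> 1 - Y k \<bullet> X l \<le> \<tau>"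
    and diag: "\<And>k. k \<in> Q \<Longrightarrow> f \<le> 1 - Y k \<bullet> X k"
    and f: "(CARD('n) + 1) * \<tau> < f" and tau: "0 \<le> \<tau>"
  shows "banach_mazur_dist ((\<lambda>x. A x + a) ` K) S \<le> 1 + (CARD('n) + 1) * (\<tau> / (f - (CARD('n) + 1) * \<tau>))"
proof -
  let ?n = "real CARD('n)"
  define F where "F k l = 1 - Y k \<bullet> X l" for k l
  define \<eta> where "\<eta> = \<tau> / (f - (?n + 1) * \<tau>)"
  have n1: "?n \<ge> 1" by simp
  have gap: "f - (?n + 1) * \<tau> > 0" using f by (simp add: algebra_simps)
  have eta: "\<eta> \<ge> 0" unfolding \<eta>_def using gap tau by (intro divide_nonneg_nonneg) linarith+
  have ftau: "\<tau> < f" using f tau n1 mult_right_mono[of 1 "?n + 1" \<tau>] gap by linarith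
  have F0: "0 \<le> F k l" if "k \<in> Q" "l \<in> Q" for k l using X Y that by (simp add: F_def)
  have inj: "inj_on X Q"
  proof
    fix k l assume "k \<in> Q" "l \<in> Q" "X k = X l"
    then show "k = l" using off[of k l] diag[of k] ftau by (cases "k = l") auto
  qed
  \<comment> \<open>Use the inequality of the index at which the coordinate is least: every other coordinate exceeds
    it, so the off-diagonal terms are controlled by the sum of the coordinates.\<close>
  have least: "(f - (?n + 1) * \<tau>) * (- \<phi> k) \<le> \<tau> * s"
    if "k \<in> Q" "\<And>l. l \<in> Q \<Longrightarrow> \<phi> k \<le> \<phi> l" "\<phi> k < 0" "sum \<phi> Q = s" "0 \<le> (\<Sum>l\<in>Q. \<phi> l * F k l)" for \<phi> k s
  proof -
    have "0 \<le> \<phi> k * F k k + (\<Sum>l\<in>Q - {k}. \<phi> l * F k l)"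
      using that(5) Q(1) that(1) by (simp add: sum.remove)
    also have "(\<Sum>l\<in>Q - {k}. \<phi> l * F k l) \<le> (\<Sum>l\<in>Q - {k}. (\<phi> l - \<phi> k) * \<tau>)"
    proof (rule sum_mono)
      fix l assume l: "l \<in> Q - {k}"
      have "\<phi> l * F k l \<le> (\<phi> l - \<phi> k) * F k l"
        using F0[of k l] l that by (intro mult_right_mono) auto
      also have "\<dots> \<le> (\<phi> l - \<phi> k) * \<tau>"
        using off[of k l] l that by (intro mult_left_mono) (auto simp: F_def)
      finally show "\<phi> l * F k l \<le> (\<phi> l - \<phi> k) * \<tau>" .
    qed
    also have "(\<Sum>l\<in>Q - {k}. (\<phi> l - \<phi> k) * \<tau>) = (s - \<phi> k - ?n * \<phi> k) * \<tau>"
      using that(1,4) Q by (simp add: sum_distrib_right[symmetric] sum_subtractf sum_diff1)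
    also have "\<phi> k * F k k \<le> \<phi> k * f"
      using diag[OF that(1)] that(3) by (simp add: F_def mult_left_mono_neg)
    finally have "0 \<le> \<phi> k * f + (s - \<phi> k - ?n * \<phi> k) * \<tau>" by simp
    then show ?thesis by (simp add: algebra_simps)
  qed
  have key: "\<phi> k \<ge> - (\<tau> * s / (f - (?n + 1) * \<tau>))"
    if "k \<in> Q" "sum \<phi> Q = s" "s \<ge> 0" "\<And>k. k \<in> Q \<Longrightarrow> 0 \<le> (\<Sum>l\<in>Q. \<phi> l * F k l)" for \<phi> k s
  proof -
    have "finite (\<phi> ` Q)" "\<phi> ` Q \<noteq> {}" using Q that(1) by auto
    then have "Min (\<phi> ` Q) \<in> \<phi> ` Q" by (rule Min_in)
    then obtain m where m1: "m \<in> Q" "Min (\<phi> ` Q) = \<phi> m" by blast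
    have m: "m \<in> Q" "\<And>l. l \<in> Q \<Longrightarrow> \<phi> m \<le> \<phi> l"
      using m1 Q(1) Min_le[of "\<phi> ` Q"] by auto
    have "\<phi> m \<ge> - (\<tau> * s / (f - (?n + 1) * \<tau>))"
    proof (cases "\<phi> m < 0")
      case True
      then show ?thesis using least[OF m True that(2) that(4)[OF m(1)]]
          pos_le_divide_eq[OF gap, of "- \<phi> m" "\<tau> * s"]
        by (simp add: mult.commute)
    next
      case False
      moreover have "0 \<le> \<tau> * s / (f - (?n + 1) * \<tau>)"
        using gap tau that(3) by (intro divide_nonneg_nonneg mult_nonneg_nonneg) linarith+
      ultimately show ?thesis by linarith
    qed
    then show ?thesis using m(2)[OF that(1)] by linarith
  qed
  have comb: "(\<Sum>l\<in>Q. \<phi> l * F k l) = sum \<phi> Q - Y k \<bullet> (\<Sum>l\<in>Q. \<phi> l *\<^sub>R X l)" for \<phi> k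
    by (simp add: F_def right_diff_distrib sum_subtractf inner_sum_right)
  let ?W = "X ` Q"
  \<comment> \<open>An affine dependence is a coordinate vector of sum 0 representing the point 0, so the bound makes
    all its entries nonnegative.\<close>
  have indep: "\<not> affine_dependent ?W"
  proof
    assume "affine_dependent ?W"
    then obtain U where U: "sum U ?W = 0" "\<exists>v\<in>?W. U v \<noteq> 0" "(\<Sum>v\<in>?W. U v *\<^sub>R v) = 0"
      using affine_dependent_explicit_finite[of ?W] Q(1) by auto
    define \<phi> where "\<phi> = (\<lambda>l. U (X l))"
    have s: "sum \<phi> Q = 0" "(\<Sum>l\<in>Q. \<phi> l *\<^sub>R X l) = 0"
      using U(1,3) by (simp_all add: sum.reindex[OF inj] \<phi>_def)
    have "\<phi> k \<ge> 0" if "k \<in> Q" for k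
      using key[OF that, of \<phi> 0] s comb by simp
    then have "\<forall>k\<in>Q. \<phi> k = 0" using s(1) Q(1) sum_nonneg_eq_0_iff by metis
    then show False using U(2) by (auto simp: \<phi>_def)
  qed
  have card: "card ?W = CARD('n) + 1" using Q inj by (simp add: card_image)
  then have hull: "affine hull ?W = UNIV"
    using affine_independent_span_eq[OF indep] by simp
  obtain V where V: "\<not> affine_dependent V" "card V = CARD('n) + 1" "S = convex hull V"
    using S unfolding regular_simplex_def by blast
  obtain B b where B: "linear B" "bij B" and BS: "(\<lambda>x. B x + b) ` S = convex hull ?W"
    using simplices_affinely_equivalent[OF V(1,2) indep card] V(3) by blast
  define c where "c = (1 / (?n + 1)) *\<^sub>R (\<Sum>l\<in>Q. X l)"
  define \<rho> where "\<rho> = 1 + (?n + 1) * \<eta>"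
  have rho: "\<rho> > 0" using eta by (simp add: \<rho>_def add_pos_nonneg)
  have "K \<subseteq> (\<lambda>x. c + \<rho> *\<^sub>R (B x + b - c)) ` S"
  proof
    fix x assume x: "x \<in> K"
    have "x \<in> affine hull ?W" using hull by simp
    then obtain U where U: "sum U ?W = 1" "(\<Sum>v\<in>?W. U v *\<^sub>R v) = x"
      using affine_hull_finite[of ?W] Q(1) by auto
    define \<phi> where "\<phi> = (\<lambda>l. U (X l))"
    have s: "sum \<phi> Q = 1" "(\<Sum>l\<in>Q. \<phi> l *\<^sub>R X l) = x"
      using U by (simp_all add: sum.reindex[OF inj] \<phi>_def)
    have ph: "\<phi> k + \<eta> \<ge> 0" if "k \<in> Q" for k
      using key[OF that, of \<phi> 1] s comb Y[OF _ x] by (simp add: \<eta>_def)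
    define p where "p = (\<Sum>l\<in>Q. ((\<phi> l + \<eta>) / \<rho>) *\<^sub>R X l)"
    have "p \<in> convex hull ?W"
      unfolding p_def
    proof (rule convex_sum[OF Q(1) convex_convex_hull])
      show "(\<Sum>l\<in>Q. (\<phi> l + \<eta>) / \<rho>) = 1"
        using rho Q s(1) by (simp add: sum_divide_distrib[symmetric] sum.distrib \<rho>_def)
    qed (use ph rho in \<open>auto intro: hull_inc\<close>)
    then have "p \<in> (\<lambda>x. B x + b) ` S" using BS by simp
    then obtain z where z: "z \<in> S" "p = B z + b" by blast
    have rp: "\<rho> *\<^sub>R p = x + \<eta> *\<^sub>R (\<Sum>l\<in>Q. X l)"
      using rho s(2) by (simp add: p_def scaleR_sum_right scaleR_add_left sum.distrib)
    have "c + \<rho> *\<^sub>R (p - c) = \<rho> *\<^sub>R p - ((?n + 1) * \<eta>) *\<^sub>R c"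
      by (simp add: \<rho>_def algebra_simps)
    also have "((?n + 1) * \<eta>) *\<^sub>R c = \<eta> *\<^sub>R (\<Sum>l\<in>Q. X l)"
      using n1 by (simp add: c_def)
    finally have "c + \<rho> *\<^sub>R (p - c) = x" using rp by simp
    then show "x \<in> (\<lambda>x. c + \<rho> *\<^sub>R (B x + b - c)) ` S" using z by (intro image_eqI[of _ _ z]) simp_all
  qed
  moreover have "(\<lambda>x. B x + b) ` S \<subseteq> K"
    unfolding BS using X K by (intro hull_minimal) auto
  ultimately have "banach_mazur_dist ((\<lambda>x. A x + a) ` K) S \<le> \<rho>"
    by (intro banach_mazur_dist_le_sandwich[OF A B rho])
  then show ?thesis by (simp add: \<rho>_def \<eta>_def add.commute)
qed

section \<open>Enclosing balls\<close>

text \<open>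
  Minimal enclosing balls, in dual form. Asking for a translate of \<open>K\<close> inside a ball of radius below \<open>R\<close>
  is a system of linear inequalities \<open>u \<bullet> (X + w) \<le> \<alpha>\<close>. If it has no solution, the bipolar theorem
  applied to the vectors \<open>(u, u \<bullet> X)\<close> yields the obstruction: functionals of mean zero whose mean value
  at their points is \<open>R\<close>.
\<close>

lemma circumscribed_ball_duality:
  fixes N :: "real^'n \<Rightarrow> real" and K :: "(real^'n) set"
  assumes N: "is_norm N" and K: "compact K" "0 \<in> K"
    and far: "\<And>w \<alpha>. 0 < \<alpha> \<Longrightarrow> \<alpha> < R \<Longrightarrow> \<exists>X\<in>K. \<alpha> < N (X + w)" and R: "0 < R"
  shows "\<exists>J b. finite J \<and> J \<subseteq> K \<times> dual_unit_ball N \<and> (\<forall>k\<in>J. 0 < b k) \<and> sum b J = 1 \<and>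
    (\<Sum>k\<in>J. b k *\<^sub>R snd k) = 0 \<and> (\<Sum>k\<in>J. b k * (snd k \<bullet> fst k)) = R"
proof -
  define h :: "(real^'n) \<times> (real^'n) \<Rightarrow> (real^'n) \<times> real"
    where "h = (\<lambda>(X, u). (u, u \<bullet> X))"
  let ?A = "K \<times> dual_unit_ball N"
  let ?G = "convex hull (h ` ?A)"
  have "continuous_on ?A h"
    unfolding h_def case_prod_beta by (intro continuous_intros)
  then have "compact (h ` ?A)"
    by (intro compact_continuous_image compact_Times K dual_unit_ball_compact[OF N])
  then have cl: "closed ?G" by (intro compact_imp_closed compact_convex_hull)
  have "0 \<in> dual_unit_ball N" by (simp add: dual_unit_ball_def is_norm_nonneg[OF N])
  then have "h (0, 0) \<in> ?G" using K(2) by (intro hull_inc imageI) simp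
  then have G0: "0 \<in> ?G" by (simp add: h_def zero_prod_def)
  have "(0, R) \<in> ?G"
  proof (rule ccontr)
    assume "(0, R) \<notin> ?G"
    then obtain a where a: "\<And>g. g \<in> ?G \<Longrightarrow> a \<bullet> g \<le> 1" "a \<bullet> (0, R) > 1"
      using polar_separation[OF cl convex_convex_hull G0] by blast
    obtain w \<tau> where aw: "a = (w, \<tau>)" by (cases a)
    have tau: "\<tau> * R > 1" using a(2) by (simp add: aw)
    then have t0: "\<tau> > 0" using R by (metis less_trans zero_less_mult_pos2 zero_less_one)
    have "N (X + w /\<^sub>R \<tau>) \<le> 1 / \<tau>" if "X \<in> K" for X
    proof (rule is_norm_le_if_dual_le[OF N])
      fix u assume "u \<in> dual_unit_ball N"
      then have "h (X, u) \<in> ?G" using that by (intro hull_inc imageI) simp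
      then have "w \<bullet> u + \<tau> * (u \<bullet> X) \<le> 1" using a(1) by (fastforce simp: aw h_def)
      moreover have "u \<bullet> (X + w /\<^sub>R \<tau>) = (w \<bullet> u + \<tau> * (u \<bullet> X)) / \<tau>"
        using t0 by (simp add: inner_right_distrib inner_commute field_simps)
      ultimately show "u \<bullet> (X + w /\<^sub>R \<tau>) \<le> 1 / \<tau>"
        using t0 by (simp add: divide_right_mono)
    qed
    moreover have "0 < 1 / \<tau>" "1 / \<tau> < R" using t0 tau by (simp_all add: field_simps)
    ultimately show False using far[of "1 / \<tau>" "w /\<^sub>R \<tau>"] by fastforce
  qed
  from convex_hull_image_combination[OF this]
  obtain J b where J: "finite J" "J \<subseteq> ?A" "\<forall>k\<in>J. 0 < b k" "sum b J = 1"
      and S: "(\<Sum>k\<in>J. b k *\<^sub>R h k) = (0, R)"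
    by (elim exE conjE)
  have "(\<Sum>k\<in>J. b k *\<^sub>R snd k) = 0" "(\<Sum>k\<in>J. b k * (snd k \<bullet> fst k)) = R"
    using arg_cong[OF S, of fst] arg_cong[OF S, of snd]
    by (simp_all add: fst_sum snd_sum h_def case_prod_beta)
  then show ?thesis using J by blast
qed

text \<open>
  If the unit ball lies in \<open>K\<close> and \<open>K\<close> lies in a translate of a ball of radius \<open>\<beta> > 1\<close>, then the two balls
  are homothetic with ratio \<open>\<beta>\<close> about a suitable centre, which bounds the distance to the ball by \<open>\<beta>\<close>.
\<close>

lemma not_in_small_ball_of_banach_mazur_dist_ge:
  fixes N :: "real^'n \<Rightarrow> real" and K :: "(real^'n) set"
  assumes N: "is_norm N" and B: "unit_ball N \<subseteq> K" and A: "linear A" "bij A"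
    and R: "1 < R" "R \<le> banach_mazur_dist ((\<lambda>x. A x + a) ` K) (unit_ball N)"
    and \<alpha>: "0 < \<alpha>" "\<alpha> < R"
  shows "\<exists>X\<in>K. \<alpha> < N (X + w)"
proof (rule ccontr)
  assume "\<not> ?thesis"
  then have le: "\<And>X. X \<in> K \<Longrightarrow> N (X + w) \<le> \<alpha>" by fastforce
  \<comment> \<open>A radius above 1, for the centre of homothety \<open>w / (\<beta> - 1)\<close> to exist.\<close>
  define \<beta> where "\<beta> = max \<alpha> ((1 + R) / 2)"
  have b: "1 < \<beta>" "\<alpha> \<le> \<beta>" "\<beta> < R" using R \<alpha> by (auto simp: \<beta>_def less_max_iff_disj)
  define c where "c = w /\<^sub>R (\<beta> - 1)"
  have "K \<subseteq> (\<lambda>x. c + \<beta> *\<^sub>R (id x + 0 - c)) ` unit_ball N"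
  proof
    fix X assume "X \<in> K"
    then have "N (X + w) \<le> \<beta>" using le b by fastforce
    then have "(X + w) /\<^sub>R \<beta> \<in> unit_ball N"
      unfolding unit_ball_def mem_Collect_eq is_norm_scale[OF N] using b by (simp add: field_simps)
    moreover have "c + \<beta> *\<^sub>R ((X + w) /\<^sub>R \<beta> - c) = X"
    proof -
      have "c + \<beta> *\<^sub>R ((X + w) /\<^sub>R \<beta> - c) = X + w - (\<beta> - 1) *\<^sub>R c"
        using b by (simp add: algebra_simps)
      then show ?thesis using b by (simp add: c_def)
    qed
    ultimately show "X \<in> (\<lambda>x. c + \<beta> *\<^sub>R (id x + 0 - c)) ` unit_ball N"
      by (intro image_eqI[of _ _ "(X + w) /\<^sub>R \<beta>"]) simp_all
  qed
  then have "banach_mazur_dist ((\<lambda>x. A x + a) ` K) (unit_ball N) \<le> \<beta>"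
    using B b by (intro banach_mazur_dist_le_sandwich[OF A linear_id bij_id, where b = 0]) auto
  then show False using R b by simp
qed

section \<open>Uniform smoothness\<close>

text \<open>
  Uniform smoothness of a norm is uniform convexity of its dual. Both \<open>y\<close> and \<open>-u\<close> nearly norm \<open>x\<close>, so
  adding their values at \<open>x + t w\<close> and \<open>x - t w\<close> bounds \<open>t (y + u) \<bullet> w\<close> by the defect \<open>1 + u \<bullet> x\<close> plus twice the
  modulus at \<open>t\<close>. The bound in the lemma is the outcome of optimising \<open>t\<close>.
\<close>

lemma dual_functionals_close_of_uniformly_smooth:
  fixes N :: "real^'n \<Rightarrow> real"
  assumes N: "is_norm N" and smooth: "uniformly_smooth N p C" and p: "1 < p" and C: "0 < C"
    and q: "q = p / (p - 1)"
    and x: "N x = 1" and y: "y \<in> dual_unit_ball N" "y \<bullet> x = 1" and u: "u \<in> dual_unit_ball N"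
    and D: "0 < D" and small: "1 + u \<bullet> x < D powr q / (q * (2 * C * p) powr (q - 1))"
  shows "(y + u) \<bullet> v \<le> D * N v"
proof (rule ccontr)
  assume "\<not> ?thesis"
  then have neg: "D * N v < (y + u) \<bullet> v" by simp
  have "v \<noteq> 0" using neg is_norm_zero[OF N] by auto
  then have Nv: "N v > 0" using is_norm_nonneg[OF N] is_norm_eq_0[OF N] by (metis less_eq_real_def)
  define w where "w = v /\<^sub>R N v"
  define s where "s = (y + u) \<bullet> w"
  have w: "N w = 1" using Nv by (simp add: w_def is_norm_scale[OF N])
  have s: "D < s" using neg Nv by (simp add: s_def w_def field_simps)
  have s0: "s > 0" using s D by simp
  have q1: "q > 1" using p by (simp add: q field_simps)
  \<comment> \<open>The choice \<open>t = (s / (2 C p)) powr (q - 1)\<close> maximises \<open>t s - 2 C t powr p\<close>.\<close>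
  define m where "m = s / (2 * C * p)"
  have m: "m > 0" using s0 C p by (simp add: m_def)
  define t where "t = m powr (q - 1)"
  have t: "t > 0" using m by (simp add: t_def)
  have "1 + t * (y \<bullet> w) \<le> N (x + t *\<^sub>R w)" "- (u \<bullet> x) + t * (u \<bullet> w) \<le> N (x - t *\<^sub>R w)"
    using dual_unit_ball_abs[OF N y(1), of "x + t *\<^sub>R w"] dual_unit_ball_abs[OF N u, of "x - t *\<^sub>R w"] y(2)
    by (simp_all add: inner_right_distrib inner_diff_right)
  then have "1 - u \<bullet> x + t * s - 2 \<le> N (x + t *\<^sub>R w) + N (x - t *\<^sub>R w) - 2"
    by (simp add: s_def inner_left_distrib distrib_left)
  moreover have "(N (x + t *\<^sub>R w) + N (x - t *\<^sub>R w) - 2) / 2 \<le> modulus_of_smoothness N t"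
    unfolding modulus_of_smoothness_def
  proof (rule cSup_upper)
    show "bdd_above {(N (x + t *\<^sub>R y) + N (x - t *\<^sub>R y) - 2) / 2 |x y. N x = 1 \<and> N y = 1}"
    proof (rule bdd_aboveI[of _ t], clarify)
      fix x y assume "N x = 1" "N y = 1"
      then show "(N (x + t *\<^sub>R y) + N (x - t *\<^sub>R y) - 2) / 2 \<le> t"
        using is_norm_triangle[OF N, of x "t *\<^sub>R y"] is_norm_triangle[OF N, of x "- t *\<^sub>R y"] t
        by (simp add: is_norm_scale[OF N] is_norm_uminus[OF N])
    qed
  qed (use x w in blast)
  moreover have "modulus_of_smoothness N t \<le> C * t powr p"
    using smooth t by (simp add: uniformly_smooth_def)
  ultimately have "1 - u \<bullet> x + t * s - 2 \<le> 2 * (C * t powr p)" by argo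
  then have gap: "t * s - 2 * (C * t powr p) \<le> 1 + u \<bullet> x" by argo
  have "(q - 1) * p = q" using p by (simp add: q field_simps)
  then have "t powr p = m powr q" by (simp add: t_def powr_powr)
  also have "\<dots> = t * m" using m powr_add[of m "q - 1" 1] by (simp add: t_def)
  finally have "2 * (C * t powr p) = t * s / p" using C p by (simp add: m_def field_simps)
  then have "t * s - 2 * (C * t powr p) = t * s / q" using p by (simp add: q field_simps)
  also have "\<dots> = s powr q / (q * (2 * C * p) powr (q - 1))"
    using s0 C p powr_add[of s "q - 1" 1] by (simp add: t_def m_def powr_divide)
  also have "\<dots> \<ge> D powr q / (q * (2 * C * p) powr (q - 1))"
    using s D q1 by (intro divide_right_mono powr_mono2) auto
  finally show False using gap small by linarith
qed

section \<open>Selecting the vertices and facets\<close>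

text \<open>
  The combinatorial core. Think of \<open>i\<close> as a contact pair \<open>(x, y)\<close> of the ball inside \<open>K\<close> and of \<open>k\<close> as a
  contact pair \<open>(X, u)\<close> of \<open>K\<close> inside a ball, with \<open>f i k = 1 - y \<bullet> X\<close>, \<open>g i k = 1 + u \<bullet> x\<close> and
  \<open>U k l = 1 + u\<^sub>k \<bullet> X\<^sub>l\<close>. Where \<open>g i k\<close> is small, \<open>y\<close> is close to \<open>-u\<close>, which is the hypothesis \<open>near\<close>.

  Call \<open>A k\<close> the set of those \<open>i\<close>. Since the average of \<open>f g\<close> is tiny, for most \<open>k\<close> the mass of
  \<open>f i k\<close> sits on \<open>A k\<close>; such \<open>k\<close> form \<open>G\<close>. In a maximal family \<open>Q \<subseteq> G\<close> with disjoint sets \<open>A k\<close>, every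
  \<open>k \<in> G\<close> shares an \<open>i\<close> with some member of \<open>Q\<close>, and the resulting clusters have nearly constant rows \<open>U k\<close>.
  The balance \<open>U_avg\<close> then gives each cluster a share of at most about 1 in the sum \<open>U_diag\<close>, which is
  about \<open>n + 1\<close>. So there are at least \<open>n + 1\<close> clusters, and disjointness makes the off-diagonal entries of
  \<open>f\<close> small.
\<close>

lemma near_diagonal_selection:
  fixes f g :: "'i \<Rightarrow> 'k \<Rightarrow> real" and U :: "'k \<Rightarrow> 'k \<Rightarrow> real"
    and a :: "'i \<Rightarrow> real" and b :: "'k \<Rightarrow> real"
    and n :: nat and \<gamma> \<delta> \<epsilon> :: real
  assumes n: "2 \<le> n" and \<delta>: "0 < \<delta>" "\<delta> \<le> 1 / (20 * real n ^ 3)" and \<gamma>: "0 < \<gamma>" "\<gamma> \<le> 2"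
    and \<epsilon>: "\<epsilon> \<le> \<gamma> * (\<delta> / (8 * real n ^ 5))"
    and I: "finite I" "\<And>i. i \<in> I \<Longrightarrow> 0 \<le> a i" "sum a I = 1"
    and J: "finite J" "\<And>k. k \<in> J \<Longrightarrow> 0 \<le> b k" "sum b J = 1"
    and f0: "\<And>i k. i \<in> I \<Longrightarrow> k \<in> J \<Longrightarrow> 0 \<le> f i k"
    and f_le: "\<And>i k. i \<in> I \<Longrightarrow> k \<in> J \<Longrightarrow> f i k \<le> 1 + 2 * real n"
    and g0: "\<And>i k. i \<in> I \<Longrightarrow> k \<in> J \<Longrightarrow> 0 \<le> g i k"
    and U_ge: "\<And>k l. k \<in> J \<Longrightarrow> l \<in> J \<Longrightarrow> 1 - 2 * real n \<le> U k l"
    and U_le: "\<And>k l. k \<in> J \<Longrightarrow> l \<in> J \<Longrightarrow> U k l \<le> 1 + 2 * real n"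
    and f_avg: "\<And>k. k \<in> J \<Longrightarrow> (\<Sum>i\<in>I. a i * f i k) = 1"
    and U_avg: "\<And>l. l \<in> J \<Longrightarrow> (\<Sum>k\<in>J. b k * U k l) = 1"
    and U_diag: "1 + (1 - \<epsilon>) * n \<le> (\<Sum>k\<in>J. b k * U k k)"
    and fg: "(\<Sum>k\<in>J. b k * (\<Sum>i\<in>I. a i * (f i k * g i k))) \<le> \<epsilon>"
    and near: "\<And>i k l. i \<in> I \<Longrightarrow> k \<in> J \<Longrightarrow> l \<in> J \<Longrightarrow> g i k < \<gamma> \<Longrightarrow> \<bar>f i l - U k l\<bar> \<le> n * \<delta>"
  shows "\<exists>Q \<phi>. Q \<subseteq> J \<and> card Q = n + 1 \<and> \<phi> ` Q \<subseteq> I \<and>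
           (\<forall>k\<in>Q. \<forall>l\<in>Q. k \<noteq> l \<longrightarrow> f (\<phi> k) l \<le> 3 * real n * \<delta>) \<and>
           (\<forall>k\<in>Q. 1 - 3 * real n * \<delta> \<le> f (\<phi> k) k)"
proof -
  define r where "r = real n"
  have r: "r \<ge> 2" using n by (simp add: r_def)
  have r3: "\<delta> * r ^ 3 \<le> 1 / 20" using \<delta> r by (simp add: r_def field_simps)
  have r3r2: "r ^ 3 \<ge> 2 * r ^ 2" and r2r: "r ^ 2 \<ge> 2 * r"
    using r by (simp_all add: power2_eq_square power3_eq_cube)
  have r2d: "\<delta> * r ^ 2 \<le> 1 / 40"
    using mult_left_mono[OF r3r2 less_imp_le[OF \<delta>(1)]] r3 by linarith
  have "\<delta> * r \<le> 1 / 80"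
    using mult_left_mono[OF r2r less_imp_le[OF \<delta>(1)]] r2d by linarith
  then have rd: "r * \<delta> \<le> 1 / 80" by (simp add: mult.commute)
  have d0: "\<delta> * r \<ge> 0" using \<delta> r by simp
  \<comment> \<open>The threshold \<open>s\<close> is \<open>10 r\<^sup>2\<close> times the bound \<open>\<delta> / (8 r\<^sup>5)\<close> on the average of \<open>h\<close> below, so by
    Markov's inequality the exceptional indices have mass at most \<open>1 / (10 r\<^sup>2)\<close>.\<close>
  define s where "s = 5 * \<delta> / (4 * r ^ 3)"
  have s0: "s > 0" using \<delta> r by (simp add: s_def)
  have s_small: "2 * s * (1 + 2 * r) \<le> r * \<delta>"
  proof -
    have "r ^ 4 = r ^ 3 * r" by (simp add: power_Suc2 eval_nat_numeral)
    moreover have "r ^ 3 \<ge> 2 ^ 3" using r by (intro power_mono) auto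
    ultimately have "r ^ 4 \<ge> 8 * r" using r by simp
    then have "10 * (1 + 2 * r) \<le> 4 * r ^ 4" using r by simp
    then have "\<delta> * (10 * (1 + 2 * r)) \<le> \<delta> * (4 * r ^ 4)" using \<delta>(1) by (intro mult_left_mono) simp_all
    then show ?thesis using r by (simp add: s_def field_simps eval_nat_numeral)
  qed
  have "2 * s * 1 \<le> 2 * s * (1 + 2 * r)" using r s0 by (intro mult_left_mono) auto
  then have s_le: "s \<le> r * \<delta>" "s \<le> 1 / 2" using s_small s0 rd by linarith+
  define A where "A k = {i \<in> I. g i k < \<gamma>}" for k
  have A: "A k \<subseteq> I" "finite (A k)" for k using I(1) by (auto simp: A_def)
  have A_in: "i \<in> I" if "i \<in> A k" for i k using that by (simp add: A_def)
  define h where "h k = (\<Sum>i\<in>I - A k. a i * f i k)" for k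
  have h0: "0 \<le> h k" if "k \<in> J" for k
    unfolding h_def using that f0 I(2) by (intro sum_nonneg mult_nonneg_nonneg) auto
  have h_split: "(\<Sum>i\<in>A k. a i * f i k) = 1 - h k" if "k \<in> J" for k
    using sum.subset_diff[OF A(1) I(1), of "\<lambda>i. a i * f i k" k] f_avg[OF that] by (simp add: h_def)
  have h_avg: "(\<Sum>k\<in>J. b k * h k) \<le> \<delta> / (8 * r ^ 5)"
  proof -
    have "\<gamma> * h k \<le> (\<Sum>i\<in>I. a i * (f i k * g i k))" if k: "k \<in> J" for k
    proof -
      have "\<gamma> * h k = (\<Sum>i\<in>I - A k. a i * (f i k * \<gamma>))" by (simp add: h_def sum_distrib_left mult_ac)
      also have "\<dots> \<le> (\<Sum>i\<in>I - A k. a i * (f i k * g i k))"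
        using k f0 I(2) by (intro sum_mono mult_left_mono) (auto simp: A_def)
      also have "\<dots> \<le> (\<Sum>i\<in>I. a i * (f i k * g i k))"
        using k f0 g0 I by (intro sum_mono2) auto
      finally show ?thesis .
    qed
    then have "(\<Sum>k\<in>J. b k * (\<gamma> * h k)) \<le> (\<Sum>k\<in>J. b k * (\<Sum>i\<in>I. a i * (f i k * g i k)))"
      using J(2) by (intro sum_mono mult_left_mono) auto
    also have "\<dots> \<le> \<gamma> * (\<delta> / (8 * r ^ 5))" using fg \<epsilon> by (simp add: r_def)
    finally have "\<gamma> * (\<Sum>k\<in>J. b k * h k) \<le> \<gamma> * (\<delta> / (8 * r ^ 5))"
      by (simp add: sum_distrib_left mult_ac)
    then show ?thesis using \<gamma> by (simp only: mult_le_cancel_left_pos)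
  qed
  define G where "G = {k \<in> J. h k \<le> s}"
  have G: "G \<subseteq> J" "finite G" using J(1) by (auto simp: G_def)
  have bad: "sum b (J - G) \<le> 1 / (10 * r ^ 2)"
  proof -
    have "s * sum b (J - G) = (\<Sum>k\<in>J - G. b k * s)" by (simp add: sum_distrib_left mult.commute)
    also have "\<dots> \<le> (\<Sum>k\<in>J - G. b k * h k)"
      using J(2) by (intro sum_mono mult_left_mono) (auto simp: G_def)
    also have "\<dots> \<le> (\<Sum>k\<in>J. b k * h k)" using J h0 by (intro sum_mono2) auto
    also have "\<dots> \<le> \<delta> / (8 * r ^ 5)" by (rule h_avg)
    also have "\<dots> = s * (1 / (10 * r ^ 2))" using r by (simp add: s_def field_simps eval_nat_numeral)
    finally show ?thesis using s0 by (simp only: mult_le_cancel_left_pos)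
  qed
  have bad0: "0 \<le> sum b (J - G)" using J(2) by (intro sum_nonneg) auto
  have mass: "1 / 2 \<le> sum a (A k) * (1 + 2 * r)" if "k \<in> G" for k
  proof -
    have "1 / 2 \<le> 1 - h k" using that s_le by (auto simp: G_def)
    also have "\<dots> = (\<Sum>i\<in>A k. a i * f i k)" using h_split that by (simp add: G_def)
    also have "\<dots> \<le> (\<Sum>i\<in>A k. a i * (1 + 2 * r))"
      using I(2) f_le that A_in by (intro sum_mono mult_left_mono) (auto simp: G_def r_def)
    finally show ?thesis by (simp add: sum_distrib_right)
  qed
  have A_ne: "A k \<noteq> {}" if "k \<in> G" for k using mass[OF that] by auto
  have A_near: "\<bar>f i l - U k l\<bar> \<le> r * \<delta>" if "i \<in> A k" "k \<in> J" "l \<in> J" for i k l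
    using near that by (simp add: A_def r_def)
  have U_good: "- (r * \<delta>) \<le> U k l" if kl: "k \<in> G" "l \<in> J" for k l
  proof -
    obtain i where i: "i \<in> A k" using A_ne[OF kl(1)] by blast
    have "k \<in> J" using kl(1) G(1) by blast
    then show ?thesis using A_near[OF i _ kl(2)] f0[OF A_in[OF i] kl(2)] by linarith
  qed
  define F where "F = {Q. Q \<subseteq> G \<and> (\<forall>k\<in>Q. \<forall>l\<in>Q. k \<noteq> l \<longrightarrow> A k \<inter> A l = {})}"
  have finF: "finite F" using G(2) by (simp add: F_def)
  have "{} \<in> F" by (simp add: F_def)
  then have "Max (card ` F) \<in> card ` F" using finF by (intro Max_in) auto
  then obtain Q where Q: "Q \<in> F" "Max (card ` F) = card Q" by blast
  have Qmax: "card Q' \<le> card Q" if "Q' \<in> F" for Q'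
    using Max_ge[of "card ` F" "card Q'"] finF that Q(2) by simp
  have QG: "Q \<subseteq> G" "finite Q" using Q(1) G(2) finite_subset by (auto simp: F_def)
  have "\<exists>j\<in>Q. A k \<inter> A j \<noteq> {}" if k: "k \<in> G" for k
  proof (rule ccontr)
    assume no: "\<not> ?thesis"
    then have "k \<notin> Q" using A_ne[OF k] by auto
    moreover have "insert k Q \<in> F" using Q(1) no k by (fastforce simp: F_def)
    ultimately show False using Qmax[of "insert k Q"] QG(2) by simp
  qed
  then obtain c where c: "\<And>k. k \<in> G \<Longrightarrow> c k \<in> Q" "\<And>k. k \<in> G \<Longrightarrow> A k \<inter> A (c k) \<noteq> {}"
    by metis
  have U_close: "U k l \<ge> U k' l - 4 * (r * \<delta>)" if k: "k \<in> G" "k' \<in> G" "c k = c k'" "l \<in> J" for k k' l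
  proof -
    obtain i i' where i: "i \<in> A k" "i \<in> A (c k)" "i' \<in> A k'" "i' \<in> A (c k)"
      using c(2) k(1-3) by (metis disjoint_iff)
    have "k \<in> J" "k' \<in> J" "c k \<in> J" using k c(1)[OF k(1)] QG(1) G(1) by auto
    then show ?thesis
      using A_near[OF i(1) _ k(4)] A_near[OF i(2) _ k(4)] A_near[OF i(3) _ k(4)] A_near[OF i(4) _ k(4)]
      by linarith
  qed
  define e where "e = 5 * (r * \<delta>) + 1 / (5 * r)"
  have e0: "e \<ge> 0" using \<delta> r by (simp add: e_def)
  have cluster: "(\<Sum>k\<in>{k \<in> G. c k = j}. b k * U k k) \<le> 1 + e" for j
  proof -
    let ?C = "{k \<in> G. c k = j}"
    have C: "?C \<subseteq> J" "finite ?C" "?C \<subseteq> G" using G by auto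
    have C0: "0 \<le> sum b ?C" using J(2) C by (intro sum_nonneg) auto
    have C1: "sum b G \<le> 1" using J G sum_mono2[OF J(1) G(1), of b] by auto
    have CG: "sum b ?C + sum b (G - ?C) = sum b G" using C(3) G(2) by (metis add.commute sum.subset_diff)
    have GC0: "0 \<le> sum b (G - ?C)" using J(2) G by (intro sum_nonneg) auto
    \<comment> \<open>Split the balance of column \<open>l\<close> into exceptional indices, other clusters and the cluster of \<open>l\<close>.
      On the last part each \<open>U k l\<close> is nearly \<open>U l l\<close>; the other two contribute almost nothing negative.\<close>
    have one: "sum b ?C * U l l \<le> 1 + e" if l: "l \<in> ?C" for l
    proof -
      have lJ: "l \<in> J" using l C by auto
      have "1 = (\<Sum>k\<in>J - G. b k * U k l) + (\<Sum>k\<in>G. b k * U k l)"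
        using sum.subset_diff[OF G(1) J(1), of "\<lambda>k. b k * U k l"] U_avg[OF lJ] by simp
      also have "(\<Sum>k\<in>G. b k * U k l) = (\<Sum>k\<in>G - ?C. b k * U k l) + (\<Sum>k\<in>?C. b k * U k l)"
        by (rule sum.subset_diff[OF C(3) G(2)])
      finally have eq: "1 = (\<Sum>k\<in>J - G. b k * U k l) + ((\<Sum>k\<in>G - ?C. b k * U k l) + (\<Sum>k\<in>?C. b k * U k l))" .
      have "(\<Sum>k\<in>J - G. b k * (- (2 * r))) \<le> (\<Sum>k\<in>J - G. b k * U k l)"
        using U_ge[OF _ lJ] J(2) by (intro sum_mono mult_left_mono) (force simp: r_def)+
      then have 1: "- (2 * r) * sum b (J - G) \<le> (\<Sum>k\<in>J - G. b k * U k l)"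
        by (simp add: sum_distrib_left sum_distrib_right mult.commute sum_negf)
      have "2 * r * sum b (J - G) \<le> 2 * r * (1 / (10 * r ^ 2))" using bad r by (intro mult_left_mono) auto
      also have "\<dots> = 1 / (5 * r)" using r by (simp add: field_simps power2_eq_square)
      finally have 1: "- (1 / (5 * r)) \<le> (\<Sum>k\<in>J - G. b k * U k l)" using 1 by linarith
      have "(\<Sum>k\<in>G - ?C. b k * (- (r * \<delta>))) \<le> (\<Sum>k\<in>G - ?C. b k * U k l)"
        using U_good[OF _ lJ] J(2) G by (intro sum_mono mult_left_mono) auto
      then have 2: "- (r * \<delta>) * sum b (G - ?C) \<le> (\<Sum>k\<in>G - ?C. b k * U k l)"
        by (simp add: sum_distrib_left sum_distrib_right mult.commute sum_negf)
      have "(\<Sum>k\<in>?C. b k * (U l l - 4 * (r * \<delta>))) \<le> (\<Sum>k\<in>?C. b k * U k l)"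
        using U_close[OF _ _ _ lJ] J(2) C l by (intro sum_mono mult_left_mono) auto
      then have 3: "sum b ?C * (U l l - 4 * (r * \<delta>)) \<le> (\<Sum>k\<in>?C. b k * U k l)"
        by (simp add: sum_distrib_right)
      have "sum b ?C * U l l \<le> 1 + 1 / (5 * r) + (r * \<delta>) * sum b (G - ?C) + 4 * (r * \<delta>) * sum b ?C"
        using eq 1 2 3 by (simp add: algebra_simps)
      moreover have "(r * \<delta>) * sum b (G - ?C) \<le> (r * \<delta>) * 1" "(r * \<delta>) * sum b ?C \<le> (r * \<delta>) * 1"
        using C0 C1 CG GC0 d0 by (intro mult_left_mono; simp add: mult.commute)+
      ultimately show ?thesis by (simp add: e_def)
    qed
    show ?thesis
    proof (cases "sum b ?C = 0")
      case True
      have "b k = 0" if "k \<in> ?C" for k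
        by (rule sum_nonneg_0[OF C(2) _ True that]) (use J(2) C(1) in blast)
      then have "(\<Sum>k\<in>?C. b k * U k k) = 0" by (intro sum.neutral) simp
      then show ?thesis using e0 by linarith
    next
      case False
      then have pos: "sum b ?C > 0" using C0 by simp
      have "(\<Sum>k\<in>?C. b k * U k k) \<le> (\<Sum>k\<in>?C. b k * ((1 + e) / sum b ?C))"
        using one J(2) C pos by (intro sum_mono mult_left_mono) (auto simp: field_simps)
      also have "\<dots> = 1 + e" unfolding sum_distrib_right[symmetric] using pos by simp
      finally show ?thesis .
    qed
  qed
  have "n + 1 \<le> card Q"
  proof (rule ccontr)
    assume "\<not> n + 1 \<le> card Q"
    then have cQ: "real (card Q) \<le> r" by (simp add: r_def)
    have "1 + (1 - \<epsilon>) * r \<le> (\<Sum>k\<in>J - G. b k * U k k) + (\<Sum>k\<in>G. b k * U k k)"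
      using sum.subset_diff[OF G(1) J(1), of "\<lambda>k. b k * U k k"] U_diag by (simp add: r_def)
    also have "(\<Sum>k\<in>G. b k * U k k) = (\<Sum>j\<in>Q. \<Sum>k\<in>{k \<in> G. c k = j}. b k * U k k)"
      using c(1) by (intro sum.group[symmetric] G(2) QG(2)) auto
    also have "\<dots> \<le> card Q * (1 + e)"
      using sum_bounded_above[of Q "\<lambda>j. \<Sum>k\<in>{k \<in> G. c k = j}. b k * U k k" "1 + e"] cluster by simp
    also have "card Q * (1 + e) \<le> r * (1 + e)" using cQ e0 by (intro mult_right_mono) auto
    also have "(\<Sum>k\<in>J - G. b k * U k k) \<le> (\<Sum>k\<in>J - G. b k * (1 + 2 * r))"
      using U_le J(2) by (intro sum_mono mult_left_mono) (auto simp: r_def)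
    also have "\<dots> = sum b (J - G) * (1 + 2 * r)" by (simp add: sum_distrib_right)
    also have "\<dots> \<le> 1 / (10 * r ^ 2) * (1 + 2 * r)" using bad r by (intro mult_right_mono) auto
    also have "\<dots> \<le> 1 / 8"
    proof -
      have "8 + 16 * r \<le> 10 * r ^ 2" using r r2r by linarith
      then show ?thesis using r by (simp add: field_simps)
    qed
    finally have main: "1 + (1 - \<epsilon>) * r \<le> 1 / 8 + r * (1 + e)" by simp
    have "r * e = 5 * (\<delta> * r ^ 2) + 1 / 5" using r by (simp add: e_def field_simps power2_eq_square)
    moreover have "\<epsilon> * r \<le> 1 / 4"
    proof -
      have "\<epsilon> * r \<le> 2 * (\<delta> / (8 * r ^ 5)) * r"
        using \<epsilon> \<gamma> \<delta> r mult_right_mono[OF \<gamma>(2), of "\<delta> / (8 * r ^ 5)"]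
        by (intro mult_right_mono) (auto simp: r_def)
      also have "\<dots> = (r * \<delta>) / (4 * r ^ 5)" using r by (simp add: field_simps)
      also have "\<dots> \<le> (r * \<delta>) / 1"
      proof (rule divide_left_mono)
        show "1 \<le> 4 * r ^ 5" using r one_le_power[of r 5] by linarith
      qed (use r d0 in \<open>simp_all add: mult.commute\<close>)
      finally show ?thesis using rd by simp
    qed
    ultimately show False using main r2d by (simp add: algebra_simps)
  qed
  then obtain Q' where Q': "Q' \<subseteq> Q" "card Q' = n + 1" by (meson obtain_subset_with_card_n)
  \<comment> \<open>Any choice works: all \<open>i\<close> in \<open>A k\<close> give nearly the same row \<open>f i\<close>, so an average over \<open>A k\<close> can be
    replaced by the value at one of its elements.\<close>
  define \<phi> where "\<phi> k = (SOME i. i \<in> A k)" for k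
  have phi: "\<phi> k \<in> A k" if "k \<in> G" for k using A_ne[OF that] by (simp add: \<phi>_def some_in_eq)
  have f_close: "\<bar>f i l - f (\<phi> k) l\<bar> \<le> 2 * (r * \<delta>)" if "k \<in> G" "l \<in> J" "i \<in> A k" for i k l
    using A_near[OF phi[OF that(1)] _ that(2)] A_near[OF that(3) _ that(2)] that(1) G(1) by fastforce
  have off: "f (\<phi> k) l \<le> 3 * (r * \<delta>)" if kl: "k \<in> Q" "l \<in> Q" "k \<noteq> l" for k l
  proof -
    have kG: "k \<in> G" "l \<in> G" "l \<in> J" using kl QG G by auto
    have "A k \<subseteq> I - A l" using Q(1) kl A by (fastforce simp: F_def)
    then have up: "(\<Sum>i\<in>A k. a i * f i l) \<le> h l"
      unfolding h_def using I f0 kG by (intro sum_mono2) auto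
    have "(\<Sum>i\<in>A k. a i * (f (\<phi> k) l - 2 * (r * \<delta>))) \<le> (\<Sum>i\<in>A k. a i * f i l)"
      using I(2) A_in f_close[OF kG(1,3)] by (intro sum_mono mult_left_mono) (auto simp: abs_le_iff algebra_simps)
    also have "\<dots> \<le> s" using up kG by (simp add: G_def)
    finally have le: "sum a (A k) * (f (\<phi> k) l - 2 * (r * \<delta>)) \<le> s" by (simp add: sum_distrib_right)
    have "f (\<phi> k) l - 2 * (r * \<delta>) \<le> r * \<delta>"
    proof (rule ccontr)
      assume "\<not> ?thesis"
      then have gt: "f (\<phi> k) l - 2 * (r * \<delta>) > r * \<delta>" by simp
      have "1 / 2 * (r * \<delta>) < sum a (A k) * (1 + 2 * r) * (f (\<phi> k) l - 2 * (r * \<delta>))"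
        using mass[OF kG(1)] gt d0 by (intro mult_le_less_imp_less) (auto simp: mult.commute)
      also have "\<dots> = (1 + 2 * r) * (sum a (A k) * (f (\<phi> k) l - 2 * (r * \<delta>)))" by simp
      also have "\<dots> \<le> (1 + 2 * r) * s" using le r by (intro mult_left_mono) auto
      finally show False using s_small by (simp add: algebra_simps)
    qed
    then show ?thesis by linarith
  qed
  have diag: "1 - 3 * (r * \<delta>) \<le> f (\<phi> k) k" if k: "k \<in> Q" for k
  proof -
    have kG: "k \<in> G" "k \<in> J" using k QG G by auto
    have "1 - s \<le> 1 - h k" using kG by (simp add: G_def)
    also have "\<dots> = (\<Sum>i\<in>A k. a i * f i k)" using h_split kG by simp
    also have "\<dots> \<le> (\<Sum>i\<in>A k. a i * (f (\<phi> k) k + 2 * (r * \<delta>)))"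
      using I(2) A_in f_close[OF kG] by (intro sum_mono mult_left_mono) (auto simp: abs_le_iff algebra_simps)
    also have "\<dots> = sum a (A k) * (f (\<phi> k) k + 2 * (r * \<delta>))" by (simp add: sum_distrib_right)
    also have "\<dots> \<le> 1 * (f (\<phi> k) k + 2 * (r * \<delta>))"
    proof (rule mult_right_mono)
      show "sum a (A k) \<le> 1" using I A sum_mono2[OF I(1) A(1), of k a] by auto
      show "0 \<le> f (\<phi> k) k + 2 * (r * \<delta>)"
        using f0[of "\<phi> k" k] phi[OF kG(1)] A(1)[of k] kG(2) d0 by (auto simp: mult.commute)
    qed
    finally show ?thesis using s_le(1) unfolding mult_1 by argo
  qed
  have QI: "\<phi> ` Q' \<subseteq> I" using phi A_in Q'(1) QG(1) by blast
  have QJ: "Q' \<subseteq> J" using Q'(1) QG(1) G(1) by blast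
  have rr: "3 * real n * \<delta> = 3 * (r * \<delta>)" by (simp add: r_def)
  have "f (\<phi> k) l \<le> 3 * real n * \<delta>" if "k \<in> Q'" "l \<in> Q'" "k \<noteq> l" for k l
    unfolding rr using off[of k l] that Q'(1) by auto
  moreover have "1 - 3 * real n * \<delta> \<le> f (\<phi> k) k" if "k \<in> Q'" for k
    unfolding rr using diag[of k] that Q'(1) by auto
  ultimately show ?thesis using Q'(2) QI QJ by (intro exI[of _ Q'] exI[of _ \<phi>]) auto
qed

section \<open>Stability of the maximal distance\<close>

text \<open>
  The heart of the argument. Both families of contact pairs are available: \<open>(x\<^sub>i, y\<^sub>i)\<close> with weights
  \<open>a\<^sub>i\<close> from the maximal ball inside the normalised body \<open>L\<close>, and \<open>(X\<^sub>k, u\<^sub>k)\<close> with weights \<open>b\<^sub>k\<close> from the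
  enclosing balls. Expanding with \<open>\<Sum> a\<^sub>i y\<^sub>i = 0\<close>, \<open>n \<Sum> a\<^sub>i (y\<^sub>i \<bullet> v) x\<^sub>i = v\<close> and \<open>\<Sum> b\<^sub>k u\<^sub>k = 0\<close> gives
  \<open>\<Sum> a\<^sub>i b\<^sub>k (1 - y\<^sub>i \<bullet> X\<^sub>k) (1 + u\<^sub>k \<bullet> x\<^sub>i) = 1 - R / n = \<epsilon>\<close>, a sum of nonnegative terms. Smoothness
  enters only through the hypothesis \<open>close\<close>, the uniform convexity of the dual at one scale.
\<close>

lemma banach_mazur_dist_simplex_le_of_far_from_ball:
  fixes N :: "real^'n \<Rightarrow> real" and K S :: "(real^'n) set" and n :: nat
    and \<epsilon> \<gamma> \<delta> :: real
  assumes n: "n = CARD('n)" "2 \<le> n" and N: "is_norm N" and K: "convex_body K" and S: "regular_simplex S"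
    and far: "(1 - \<epsilon>) * n \<le> banach_mazur_dist K (unit_ball N)"
    and close: "\<And>x y u v. N x = 1 \<Longrightarrow> y \<in> dual_unit_ball N \<Longrightarrow> y \<bullet> x = 1 \<Longrightarrow> u \<in> dual_unit_ball N
      \<Longrightarrow> 1 + u \<bullet> x < \<gamma> \<Longrightarrow> (y + u) \<bullet> v \<le> \<delta> / 2 * N v"
    and \<gamma>: "0 < \<gamma>" and \<delta>: "0 < \<delta>" "\<delta> \<le> 1 / (20 * real n ^ 3)"
    and \<epsilon>: "0 \<le> \<epsilon>" "\<epsilon> \<le> \<gamma> * (\<delta> / (8 * real n ^ 5))"
  shows "banach_mazur_dist K S \<le> 1 + 40 * real n ^ 3 * \<delta>"
proof -
  have r: "real n \<ge> 2" using n(2) by simp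
  obtain T t L where T: "linear T" "bij T" and KL: "K = (\<lambda>x. T x + t) ` L"
    and L: "compact L" "convex L" "unit_ball N \<subseteq> L"
    and max: "\<forall>A c. (\<forall>x\<in>unit_ball N. A *v x + c \<in> L) \<longrightarrow> det A \<le> 1"
    using normalized_maximal_position[OF N K] by (elim exE conjE)
  obtain I a where I: "finite I" "\<forall>i\<in>I. 0 < a i" "sum a I = 1"
    and I1: "\<forall>i\<in>I. N (fst i) = 1 \<and> snd i \<in> dual_unit_ball N \<and> snd i \<bullet> fst i = 1 \<and> (\<forall>z\<in>L. snd i \<bullet> z \<le> 1)"
    and I_center: "(\<Sum>i\<in>I. a i *\<^sub>R snd i) = 0"
    and I_id: "\<forall>v. real CARD('n) *\<^sub>R (\<Sum>i\<in>I. (a i * (snd i \<bullet> v)) *\<^sub>R fst i) = v"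
    using john_decomposition[OF N L(2) compact_imp_closed[OF L(1)] L(3) max] by (elim exE conjE)
  \<comment> \<open>By the decomposition \<open>N X\<close> is at most \<open>n\<close> times the average of \<open>\<bar>y \<bullet> X\<bar> \<le> 2 - y \<bullet> X\<close>, which is 2.\<close>
  have NX: "N X \<le> 2 * real n" if "X \<in> L" for X
  proof -
    have "N X = n * N (\<Sum>i\<in>I. (a i * (snd i \<bullet> X)) *\<^sub>R fst i)"
      using arg_cong[OF spec[OF I_id, of X], of N] n(1) by (simp add: is_norm_scale[OF N])
    also have "\<dots> \<le> n * (\<Sum>i\<in>I. N ((a i * (snd i \<bullet> X)) *\<^sub>R fst i))"
      by (intro mult_left_mono is_norm_sum_le[OF N]) simp
    also have "\<dots> \<le> n * (\<Sum>i\<in>I. a i * (2 - snd i \<bullet> X))"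
    proof (intro mult_left_mono sum_mono)
      fix i assume i: "i \<in> I"
      then have "snd i \<bullet> X \<le> 1" using I1 that by blast
      then have "\<bar>snd i \<bullet> X\<bar> \<le> 2 - snd i \<bullet> X" by linarith
      moreover have ai: "0 < a i" using I(2) i by blast
      ultimately have "a i * \<bar>snd i \<bullet> X\<bar> \<le> a i * (2 - snd i \<bullet> X)"
        by (intro mult_left_mono) auto
      then show "N ((a i * (snd i \<bullet> X)) *\<^sub>R fst i) \<le> a i * (2 - snd i \<bullet> X)"
        using I1 i ai by (simp add: is_norm_scale[OF N] abs_mult abs_of_pos)
    qed simp
    also have "(\<Sum>i\<in>I. a i * (2 - snd i \<bullet> X)) = 2 - (\<Sum>i\<in>I. a i *\<^sub>R snd i) \<bullet> X"
      using I(3) by (simp add: right_diff_distrib sum_subtractf inner_sum_left sum_distrib_right[symmetric])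
    finally show ?thesis by (simp add: I_center)
  qed
  have d_small: "\<delta> \<le> 1 / 160"
  proof -
    have "real n ^ 3 \<ge> 2 ^ 3" using r by (intro power_mono) auto
    then have "1 / (20 * real n ^ 3) \<le> 1 / 160" using r by (simp add: field_simps)
    then show ?thesis using \<delta> by simp
  qed
  \<comment> \<open>Otherwise \<open>close\<close> would apply to \<open>u = y\<close>, which is far from \<open>-y\<close>.\<close>
  have g2: "\<gamma> \<le> 2"
  proof (rule ccontr)
    assume "\<not> \<gamma> \<le> 2"
    have "I \<noteq> {}" using I(3) by auto
    then obtain i where i: "i \<in> I" by blast
    have "(snd i + snd i) \<bullet> fst i \<le> \<delta> / 2 * N (fst i)"
      using I1 i \<open>\<not> \<gamma> \<le> 2\<close> by (intro close[of "fst i"]) auto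
    moreover have "(snd i + snd i) \<bullet> fst i = 1 + 1" "N (fst i) = 1"
      using I1 i by (simp_all only: inner_left_distrib)
    ultimately show False using d_small by simp
  qed
  have "\<gamma> * (\<delta> / (8 * real n ^ 5)) \<le> 2 * (\<delta> / 1)"
  proof (intro mult_mono divide_left_mono)
    show "1 \<le> 8 * real n ^ 5" using one_le_power[of "real n" 5] r by linarith
  qed (use g2 \<gamma> \<delta>(1) r in auto)
  then have e_small: "\<epsilon> \<le> 1 / 4" using \<epsilon> d_small by linarith
  define R where "R = (1 - \<epsilon>) * n"
  have "3 / 4 * 2 \<le> R" unfolding R_def using e_small r by (intro mult_mono) auto
  then have R1: "1 < R" by simp
  have "\<exists>X\<in>L. \<alpha> < N (X + w)" if "0 < \<alpha>" "\<alpha> < R" for w \<alpha>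
    using not_in_small_ball_of_banach_mazur_dist_ge[OF N L(3) T R1 _ that] far KL by (simp add: R_def)
  moreover have "0 \<in> L" using zero_in_unit_ball[OF N] L(3) by blast
  ultimately obtain J b where J: "finite J" "J \<subseteq> L \<times> dual_unit_ball N" "\<forall>k\<in>J. 0 < b k" "sum b J = 1"
    and J_center: "(\<Sum>k\<in>J. b k *\<^sub>R snd k) = 0" and J_R: "(\<Sum>k\<in>J. b k * (snd k \<bullet> fst k)) = R"
    using circumscribed_ball_duality[OF N L(1), of R] R1 by auto
  have J1: "fst k \<in> L" "snd k \<in> dual_unit_ball N" if "k \<in> J" for k
    using J(2) that by auto
  have absX: "\<bar>u \<bullet> fst k\<bar> \<le> 2 * real n" if "k \<in> J" "u \<in> dual_unit_ball N" for k u
    using dual_unit_ball_abs[OF N that(2), of "fst k"] NX[OF J1(1)[OF that(1)]] by linarith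
  have U1: "\<bar>snd k \<bullet> fst i\<bar> \<le> 1" if "i \<in> I" "k \<in> J" for i k
    using dual_unit_ball_abs[OF N J1(2)[OF that(2)], of "fst i"] I1 that by simp
  have avg: "(\<Sum>i\<in>I. a i * (snd i \<bullet> X)) = 0" for X
    using I_center by (metis (mono_tags, lifting) inner_scaleR_left inner_sum_left inner_zero_left sum.cong)
  have avgJ: "(\<Sum>k\<in>J. b k * (snd k \<bullet> X)) = 0" for X
    using J_center by (metis (mono_tags, lifting) inner_scaleR_left inner_sum_left inner_zero_left sum.cong)
  define z where "z = (\<Sum>i\<in>I. a i *\<^sub>R fst i)"
  have fg: "(\<Sum>i\<in>I. a i * ((1 - snd i \<bullet> X) * (1 + u \<bullet> fst i))) = 1 + u \<bullet> z - (u \<bullet> X) / n" for X u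
  proof -
    have "u \<bullet> X = n * (\<Sum>i\<in>I. a i * (snd i \<bullet> X) * (u \<bullet> fst i))"
      using arg_cong[OF spec[OF I_id, of X], of "\<lambda>v. u \<bullet> v"] n(1)
      by (simp add: inner_sum_right)
    then have "(\<Sum>i\<in>I. a i * (snd i \<bullet> X) * (u \<bullet> fst i)) = (u \<bullet> X) / n" using r by simp
    moreover have "u \<bullet> z = (\<Sum>i\<in>I. a i * (u \<bullet> fst i))" by (simp add: z_def inner_sum_right)
    ultimately show ?thesis using avg[of X] I(3)
      by (simp add: algebra_simps sum.distrib sum_subtractf)
  qed
  have total: "(\<Sum>k\<in>J. b k * (\<Sum>i\<in>I. a i * ((1 - snd i \<bullet> fst k) * (1 + snd k \<bullet> fst i)))) = \<epsilon>"
  proof -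
    have "(\<Sum>k\<in>J. b k * (1 + snd k \<bullet> z - (snd k \<bullet> fst k) / n)) = sum b J + (\<Sum>k\<in>J. b k * (snd k \<bullet> z)) - (\<Sum>k\<in>J. b k * (snd k \<bullet> fst k)) / n"
      by (simp add: algebra_simps sum.distrib sum_subtractf sum_divide_distrib)
    also have "\<dots> = \<epsilon>" using J(4) avgJ[of z] J_R r by (simp add: R_def)
    finally show ?thesis unfolding fg .
  qed
  have "\<exists>Q \<phi>. Q \<subseteq> J \<and> card Q = n + 1 \<and> \<phi> ` Q \<subseteq> I \<and>
           (\<forall>k\<in>Q. \<forall>l\<in>Q. k \<noteq> l \<longrightarrow> 1 - snd (\<phi> k) \<bullet> fst l \<le> 3 * real n * \<delta>) \<and>
           (\<forall>k\<in>Q. 1 - 3 * real n * \<delta> \<le> 1 - snd (\<phi> k) \<bullet> fst k)"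
  proof (rule near_diagonal_selection[where f = "\<lambda>i k. 1 - snd i \<bullet> fst k" and g = "\<lambda>i k. 1 + snd k \<bullet> fst i"
        and U = "\<lambda>k l. 1 + snd k \<bullet> fst l" and a = a and b = b and \<gamma> = \<gamma> and \<epsilon> = \<epsilon>])
    show "(\<Sum>i\<in>I. a i * (1 - snd i \<bullet> fst k)) = 1" for k
      using avg[of "fst k"] I(3) by (simp add: right_diff_distrib sum_subtractf)
    show "(\<Sum>k\<in>J. b k * (1 + snd k \<bullet> fst l)) = 1" for l
      using avgJ[of "fst l"] J(4) by (simp add: distrib_left sum.distrib)
    show "1 + (1 - \<epsilon>) * n \<le> (\<Sum>k\<in>J. b k * (1 + snd k \<bullet> fst k))"
      using J_R J(4) by (simp add: distrib_left sum.distrib R_def)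
    fix i k assume i: "i \<in> I" and k: "k \<in> J"
    show "0 \<le> 1 - snd i \<bullet> fst k" using I1 i J1[OF k] by auto
    have "\<bar>snd i \<bullet> fst k\<bar> \<le> 2 * real n" using absX[OF k] I1 i by blast
    then show "1 - snd i \<bullet> fst k \<le> 1 + 2 * real n" by linarith
    show "0 \<le> 1 + snd k \<bullet> fst i" using U1[OF i k] by linarith
    fix l assume l: "l \<in> J" and g: "1 + snd k \<bullet> fst i < \<gamma>"
    have cl: "(snd i + snd k) \<bullet> v \<le> \<delta> / 2 * N v" for v
      using I1 i J1[OF k] g by (intro close[of "fst i"]) auto
    have "\<delta> / 2 * N (fst l) \<le> \<delta> / 2 * (2 * n)"
      using NX[OF J1(1)[OF l]] \<delta>(1) by (intro mult_left_mono) auto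
    then show "\<bar>1 - snd i \<bullet> fst l - (1 + snd k \<bullet> fst l)\<bar> \<le> n * \<delta>"
      using cl[of "fst l"] cl[of "- fst l"] by (simp add: is_norm_uminus[OF N] inner_left_distrib mult.commute)
  next
    fix k l assume k: "k \<in> J" "l \<in> J"
    show "1 - 2 * real n \<le> 1 + snd k \<bullet> fst l" "1 + snd k \<bullet> fst l \<le> 1 + 2 * real n"
      using absX[OF k(2) J1(2)[OF k(1)]] by linarith+
  qed (use n \<delta> \<gamma> g2 \<epsilon> I J total in \<open>auto intro: less_imp_le\<close>)
  then obtain Q \<phi> where Q: "Q \<subseteq> J" "card Q = n + 1" "\<phi> ` Q \<subseteq> I"
    and off: "\<forall>k\<in>Q. \<forall>l\<in>Q. k \<noteq> l \<longrightarrow> 1 - snd (\<phi> k) \<bullet> fst l \<le> 3 * real n * \<delta>"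
    and diag: "\<forall>k\<in>Q. 1 - 3 * real n * \<delta> \<le> 1 - snd (\<phi> k) \<bullet> fst k"
    by blast
  have r2: "real n ^ 2 \<ge> 2 * n" and r3: "real n ^ 3 \<ge> 2 * real n ^ 2"
    using r by (simp_all add: power2_eq_square power3_eq_cube)
  have r2d: "\<delta> * real n ^ 2 \<le> 1 / 40"
  proof -
    have "\<delta> * (2 * real n ^ 2) \<le> \<delta> * real n ^ 3" using r3 \<delta>(1) by (intro mult_left_mono) auto
    also have "\<dots> \<le> 1 / 20" using \<delta>(2) r by (simp add: field_simps)
    finally show ?thesis by simp
  qed
  have rd: "2 * (\<delta> * n) \<le> \<delta> * real n ^ 2"
    using mult_left_mono[OF r2 less_imp_le[OF \<delta>(1)]] by simp
  have gap: "1 / 2 \<le> 1 - 3 * real n * \<delta> - (n + 1) * (3 * real n * \<delta>)"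
  proof -
    have "(n + 1) * (3 * real n * \<delta>) = 3 * (\<delta> * real n ^ 2) + 3 * (\<delta> * n)"
      by (simp add: power2_eq_square algebra_simps)
    moreover have "3 * real n * \<delta> = 3 * (\<delta> * n)" by simp
    ultimately show ?thesis using rd r2d by linarith
  qed
  have finQ: "finite Q" using Q(1) J(1) finite_subset by blast
  have Qn: "card Q = CARD('n) + 1" using Q(2) n(1) by simp
  have "banach_mazur_dist ((\<lambda>x. T x + t) ` L) S
      \<le> 1 + (CARD('n) + 1) * ((3 * real n * \<delta>) / ((1 - 3 * real n * \<delta>) - (CARD('n) + 1) * (3 * real n * \<delta>)))"
  proof (rule banach_mazur_dist_simplex_le[OF S T L(2) finQ Qn, where X = fst and Y = "\<lambda>k. snd (\<phi> k)"])
    show "(CARD('n) + 1) * (3 * real n * \<delta>) < 1 - 3 * real n * \<delta>" using gap n(1) by simp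
    show "snd (\<phi> k) \<bullet> z \<le> 1" if "k \<in> Q" "z \<in> L" for k z using Q(3) I1 that by blast
  qed (use Q(1) J1(1) off diag \<delta>(1) in auto)
  also have "\<dots> \<le> 1 + (n + 1) * ((3 * real n * \<delta>) / (1 / 2))"
    unfolding n(1)[symmetric] using gap \<delta>(1) by (intro add_left_mono mult_left_mono divide_left_mono) auto
  also have "\<dots> \<le> 1 + 40 * real n ^ 3 * \<delta>"
  proof -
    have "(n + 1) * ((3 * real n * \<delta>) / (1 / 2)) = 6 * (\<delta> * real n ^ 2) + 6 * (\<delta> * n)"
      by (simp add: power2_eq_square algebra_simps)
    also have "\<dots> \<le> 9 * (\<delta> * real n ^ 2)" using rd by linarith
    also have "\<dots> \<le> 40 * (\<delta> * real n ^ 3)"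
    proof -
      have "\<delta> * (2 * real n ^ 2) \<le> \<delta> * real n ^ 3" using r3 \<delta>(1) by (intro mult_left_mono) auto
      moreover have "0 \<le> \<delta> * real n ^ 2" using \<delta>(1) by simp
      ultimately show ?thesis by linarith
    qed
    finally show ?thesis by (simp add: mult_ac)
  qed
  finally show ?thesis by (simp add: KL)
qed

text \<open>
  The scale is \<open>\<delta> / 2\<close> in the dual norm, because points of the normalised body have norm at most
  \<open>2 n\<close>: functionals at that distance differ by at most \<open>n \<delta>\<close> on the body.
\<close>

lemma banach_mazur_dist_simplex_le_of_uniformly_smooth:
  fixes N :: "real^'n \<Rightarrow> real" and K S :: "(real^'n) set" and n :: nat
  assumes n: "n = CARD('n)" "2 \<le> n" and N: "is_norm N" and K: "convex_body K" and S: "regular_simplex S"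
    and p: "1 < p" and C: "0 < C" and smooth: "uniformly_smooth N p C" and q: "q = p / (p - 1)"
    and \<delta>: "0 < \<delta>" "\<delta> \<le> 1 / (20 * real n ^ 3)"
    and \<epsilon>: "0 \<le> \<epsilon>" "\<epsilon> \<le> (\<delta> / 2) powr q / (q * (2 * C * p) powr (q - 1)) * (\<delta> / (8 * real n ^ 5))"
    and far: "(1 - \<epsilon>) * n \<le> banach_mazur_dist K (unit_ball N)"
  shows "banach_mazur_dist K S \<le> 1 + 40 * real n ^ 3 * \<delta>"
proof (rule banach_mazur_dist_simplex_le_of_far_from_ball[OF n N K S far _ _ \<delta> \<epsilon>])
  have "q > 0" using p by (simp add: q)
  then show "0 < (\<delta> / 2) powr q / (q * (2 * C * p) powr (q - 1))" using \<delta>(1) C p by simp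
  show "(y + u) \<bullet> v \<le> \<delta> / 2 * N v"
    if "N x = 1" "y \<in> dual_unit_ball N" "y \<bullet> x = 1" "u \<in> dual_unit_ball N"
      "1 + u \<bullet> x < (\<delta> / 2) powr q / (q * (2 * C * p) powr (q - 1))" for x y u v
    using dual_functionals_close_of_uniformly_smooth[OF N smooth p C q that(1-4) _ that(5)] \<delta>(1) by simp
qed

theorem corollary7:
  fixes N :: "real^'n \<Rightarrow> real"
    and K S :: "(real^'n) set"
    and n :: nat
    and p q C \<epsilon> \<epsilon>\<^sub>0 C\<^sub>0 :: real
  assumes "n = CARD('n)" and "2 \<le> n"
    and "is_norm N"
    and "convex_body K"
    and "regular_simplex S"
    and "1 < p" and "p \<le> 2" and "0 < C"
    and "uniformly_smooth N p C"
    and "q = p / (p - 1)"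
    and "\<epsilon>\<^sub>0 = (q - 1) powr (q - 1) / q powr q *
           inverse (2 powr (q + 1) * 40 powr (q + 1) * C powr (q - 1) * n powr (5 * q + 4))"
    and "C\<^sub>0 = 40 * real n ^ 3 *
           (C powr (q - 1) * 2 powr (2 * q + 2) * q powr q * n powr (2 * q + 1)
              / (q - 1) powr (q - 1)) powr (1 / (q + 1))"
    and "0 \<le> \<epsilon>" and "\<epsilon> \<le> \<epsilon>\<^sub>0"
    and "banach_mazur_dist K (unit_ball N) \<ge> (1 - \<epsilon>) * n"
  shows "banach_mazur_dist K S \<le> 1 + C\<^sub>0 * \<epsilon> powr (1 / (q + 1))"
proof -
  have stab: "banach_mazur_dist K S \<le> 1 + 40 * real n ^ 3 * \<delta>"
    if "0 < \<delta>" "\<delta> \<le> 1 / (20 * real n ^ 3)"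
      "\<epsilon> \<le> (\<delta> / 2) powr q / (q * (2 * C * p) powr (q - 1)) * (\<delta> / (8 * real n ^ 5))" for \<delta>
    by (rule banach_mazur_dist_simplex_le_of_uniformly_smooth[OF assms(1-6,8-10) that(1,2) assms(13) that(3) assms(15)])
  have q2: "q \<ge> 2" using assms(6,7) by (simp add: assms(10) field_simps)
  define r where "r = real n"
  have r: "r \<ge> 2" using assms(2) by (simp add: r_def)
  define H where "H = C powr (q - 1) * q powr q / (q - 1) powr (q - 1)"
  have H: "H > 0" using assms(8) q2 by (simp add: H_def)
  have pq: "p = q / (q - 1)" using assms(6) by (simp add: assms(10) field_simps)
  have \<kappa>: "q * (2 * C * p) powr (q - 1) = 2 powr (q - 1) * H"
  proof -
    have "(2 * C * p) powr (q - 1) = 2 powr (q - 1) * C powr (q - 1) * (q powr (q - 1) / (q - 1) powr (q - 1))"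
      using assms(8) q2 by (simp add: pq powr_mult powr_divide)
    moreover have "q powr q = q * q powr (q - 1)" using q2 powr_add[of q 1 "q - 1"] by simp
    ultimately show ?thesis by (simp add: H_def)
  qed
  \<comment> \<open>For \<open>\<epsilon> = 0\<close> every small positive \<open>\<delta>\<close> is admissible. For \<open>\<epsilon> > 0\<close> take \<open>\<delta>\<close> with
    \<open>40 n\<^sup>3 \<delta> = C\<^sub>0 \<epsilon> powr (1 / (q + 1))\<close>; then \<open>\<epsilon> \<le> \<epsilon>\<^sub>0\<close> says exactly that \<open>\<delta> \<le> 1 / (20 n\<^sup>3)\<close>.\<close>
  show ?thesis
  proof (cases "\<epsilon> = 0")
    case True
    have "banach_mazur_dist K S \<le> 1"
    proof (rule field_le_epsilon)
      fix e :: real assume e: "e > 0"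
      define \<delta> where "\<delta> = min (1 / (20 * real n ^ 3)) (e / (40 * real n ^ 3))"
      have d: "\<delta> > 0" "\<delta> \<le> 1 / (20 * real n ^ 3)" using e r by (simp_all add: \<delta>_def r_def)
      have "banach_mazur_dist K S \<le> 1 + 40 * real n ^ 3 * \<delta>"
        using d q2 True by (intro stab) simp_all
      also have "\<dots> \<le> 1 + 40 * real n ^ 3 * (e / (40 * real n ^ 3))"
        by (intro add_left_mono mult_left_mono) (simp_all add: \<delta>_def)
      also have "\<dots> = 1 + e" using r by (simp add: r_def)
      finally show "banach_mazur_dist K S \<le> 1 + e" .
    qed
    then show ?thesis using True by simp
  next
    case False
    then have e: "\<epsilon> > 0" using assms(13) by simp
    define Z where "Z = H * 2 powr (2 * q + 2) * r powr (2 * q + 1) * \<epsilon>"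
    define \<delta> where "\<delta> = Z powr (1 / (q + 1))"
    have Z: "Z > 0" using H r e by (simp add: Z_def)
    have d: "\<delta> > 0" using Z by (simp add: \<delta>_def)
    have dZ: "\<delta> powr (q + 1) = Z" using Z q2 by (simp add: \<delta>_def powr_powr)
    have "Z \<le> (1 / (20 * r ^ 3)) powr (q + 1)"
    proof -
      have "(r ^ 3) powr (q + 1) = (r powr 3) powr (q + 1)" using r by simp
      also have "\<dots> = r powr (3 * q + 3)" unfolding powr_powr by (simp add: algebra_simps)
      finally have r3: "(r ^ 3) powr (q + 1) = r powr (3 * q + 3)" .
      have r5: "r powr (5 * q + 4) = r powr (2 * q + 1) * r powr (3 * q + 3)" by (simp add: powr_add[symmetric])
      have t: "2 powr (2 * q + 2) = 2 powr (q + 1) * 2 powr (q + 1 :: real)" by (simp add: powr_add[symmetric])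
      have f: "40 powr (q + 1) = 2 powr (q + 1) * 20 powr (q + 1)" by (simp add: powr_mult[symmetric])
      have "\<epsilon>\<^sub>0 = inverse (H * 2 powr (2 * q + 2) * 20 powr (q + 1) * r powr (2 * q + 1) * r powr (3 * q + 3))"
        unfolding assms(11) r_def[symmetric] r5 t f H_def by (simp add: field_simps)
      then have "Z \<le> H * 2 powr (2 * q + 2) * r powr (2 * q + 1) *
          inverse (H * 2 powr (2 * q + 2) * 20 powr (q + 1) * r powr (2 * q + 1) * r powr (3 * q + 3))"
        unfolding Z_def using assms(14) H by (intro mult_left_mono) auto
      also have "\<dots> = inverse (20 powr (q + 1) * r powr (3 * q + 3))" using H r by (simp add: field_simps)
      also have "\<dots> = (1 / (20 * r ^ 3)) powr (q + 1)"
        unfolding r3[symmetric] using r by (simp add: powr_divide powr_mult inverse_eq_divide)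
      finally show ?thesis .
    qed
    then have "\<delta> \<le> ((1 / (20 * r ^ 3)) powr (q + 1)) powr (1 / (q + 1))"
      unfolding \<delta>_def using Z q2 by (intro powr_mono2) auto
    also have "\<dots> = 1 / (20 * r ^ 3)" using q2 r by (simp add: powr_powr)
    finally have d_le: "\<delta> \<le> 1 / (20 * real n ^ 3)" by (simp add: r_def)
    \<comment> \<open>The admissibility condition on \<open>\<delta>\<close> holds with a factor \<open>r powr (2 q - 4) \<ge> 1\<close> to spare, as \<open>q \<ge> 2\<close>.\<close>
    have "\<epsilon> \<le> r powr (2 * q - 4) * \<epsilon>"
      using r q2 e ge_one_powr_ge_zero[of r "2 * q - 4"] by (simp add: mult_le_cancel_right1)
    also have "\<dots> = Z / (2 powr q * (2 powr (q - 1) * H) * (8 * r ^ 5))"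
    proof -
      have "r powr (2 * q + 1) = r powr (2 * q - 4) * r powr 5"
        unfolding powr_add[symmetric] by (simp add: add.commute)
      then have r5: "r powr (2 * q + 1) = r powr (2 * q - 4) * r ^ 5" using r by simp
      have "(2::real) powr (2 * q + 2) = 2 powr q * 2 powr (q - 1) * 2 powr 3"
        unfolding powr_add[symmetric] by (simp add: add.commute)
      then have t: "(2::real) powr (2 * q + 2) = 2 powr q * 2 powr (q - 1) * 8" by simp
      show ?thesis unfolding Z_def r5 t using H r by (simp add: field_simps)
    qed
    also have "\<dots> = (\<delta> / 2) powr q / (q * (2 * C * p) powr (q - 1)) * (\<delta> / (8 * real n ^ 5))"
    proof -
      have "Z = \<delta> powr q * \<delta>" using dZ d by (simp add: powr_add)
      then show ?thesis unfolding \<kappa> using d by (simp add: powr_divide r_def)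
    qed
    finally have "banach_mazur_dist K S \<le> 1 + 40 * real n ^ 3 * \<delta>" by (intro stab d d_le)
    also have "40 * real n ^ 3 * \<delta> = C\<^sub>0 * \<epsilon> powr (1 / (q + 1))"
    proof -
      have "Z = C powr (q - 1) * 2 powr (2 * q + 2) * q powr q * n powr (2 * q + 1)
              / (q - 1) powr (q - 1) * \<epsilon>" by (simp add: Z_def H_def r_def)
      then show ?thesis using e q2 assms(8) by (simp add: \<delta>_def assms(12) powr_mult powr_divide)
    qed
    finally show ?thesis .
  qed
qed

end
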